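(* Let $(U_n)_{n\ge 0}$ be the urn scheme with innovations on the Borel space $S$ with replacement kernel $(P_s)_{s\in S}$ started from an arbitrary non-zero finite counting measure $U_0$ on $S$, where $P_s(C+\xi(\mathbf 1)\ge 0)=1$ for all $s\in S$. Assume that: the function $s\mapsto E_s(C)$ is constant on $S$; there are a non-zero finite measure $\mu$ on $S$ and a measurable function $a:S\to(0,\infty)$ bounded away from $0$ and from $\infty$ such that $E_s(\xi(f))=a(s)\mu(f)$ for all $s\in S$ and all $f\in\mathcal L^\infty$; and $$0<\inf_{s\in S}P_s(C+\xi(\mathbf 1)\ge 1)\quad\text{and}\quad \sup_{s\in S}E_s\big((C+\xi(\mathbf 1))^2\big)<\infty.$$ Let $\lambda_1=E_s(C)+\mu(a)$. Then for every $f\in\mathcal L^\infty$, $$\lim_{n\to\infty}n^{-1}U_n(f)=\lambda_1\bar\mu(f)\quad\text{a.s.},$$ and, as a consequence, also $$\lim_{n\to\infty}\bar U_n(f)=\bar\mu(f)\quad\text{a.s.}$$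
   Context: $S$ is a Borel space with its Borel sigma-field. $\mathcal L^\infty$ is the space of bounded measurable functions $f:S\to\mathbb R$; $\mathbf 1$ is the function identically $1$. For a finite measure $\nu$ on $S$, $\nu(f)=\int_S f\,\mathrm d\nu$, so $\nu(\mathbf 1)$ is the total mass; if $\nu\neq 0$, $\bar\nu=\nu(\mathbf 1)^{-1}\nu$. $\mathcal N_S$ is the (Borel) space of finite counting measures on $S$ (finite sums of Dirac masses, including $0$). Replacement kernel: $(P_s)_{s\in S}$ is a measurable kernel such that, for each $s$, $P_s$ is a probability law of a pair $(C,\xi)$ with values in $\{-1,0,1,2,\dots\}\times\mathcal N_S$; $E_s$ denotes expectation under $P_s$. Urn scheme: $(U_n)_{n\ge0}$ is the Markov chain on $\mathcal N_S$ defined as follows. For every $n\ge0$, conditionally on the history up to step $n$, sample a color $\sigma_n$ with law $\bar U_n$; conditionally on this history and on $\sigma_n=s$, sample $(C_{n+1},\xi_{n+1})$ with law $P_s$; then set $U_{n+1}=U_n+C_{n+1}\delta_{\sigma_n}+\xi_{n+1}$. The condition $P_s(C+\xi(\mathbf 1)\ge0)=1$ ensures that the urn never becomes empty. *)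

theory Defs
  imports "HOL-Probability.Probability"
begin

definition borel_space :: "'a measure \<Rightarrow> bool" where
  "borel_space S \<longleftrightarrow>
     (\<exists>B::real set. \<exists>f g. B \<in> sets borel \<and> B \<subseteq> {0..1} \<and>
        f \<in> measurable S (restrict_space borel B) \<and>
        g \<in> measurable (restrict_space borel B) S \<and>
        (\<forall>x\<in>space S. g (f x) = x) \<and> (\<forall>y\<in>B. f (g y) = y))"

definition bounded_measurable :: "'a measure \<Rightarrow> ('a \<Rightarrow> real) set" where
  "bounded_measurable S = {f \<in> borel_measurable S. bounded (f ` space S)}"

definition normalized :: "'a measure \<Rightarrow> 'a measure" where
  "normalized \<nu> = scale_measure (inverse (emeasure \<nu> (space \<nu>))) \<nu>"

text \<open>The finite multiset \<open>X\<close> lists the atoms, so the empty multiset gives the zero measure.\<close>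

definition counting_measures :: "'a measure \<Rightarrow> 'a measure set" where
  "counting_measures S =
     {\<nu>. sets \<nu> = sets S \<and>
         (\<exists>X. set_mset X \<subseteq> space S \<and>
              (\<forall>A\<in>sets S. emeasure \<nu> A = (\<Sum>x\<in>#X. emeasure (return S x) A)))}"

text \<open>The sigma-field is the one generated by the evaluation maps \<open>\<nu> \<mapsto> \<nu>(A)\<close>.\<close>

definition counting_space :: "'a measure \<Rightarrow> 'a measure measure" where
  "counting_space S =
     (SUP A\<in>sets S. vimage_algebra (counting_measures S) (\<lambda>\<nu>. emeasure \<nu> A) borel)"

definition replacement_space :: "'a measure \<Rightarrow> (int \<times> 'a measure) measure" where
  "replacement_space S = count_space {-1..} \<Otimes>\<^sub>M counting_space S"

abbreviation total_mass :: "'a measure \<Rightarrow> real" where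
  "total_mass \<nu> \<equiv> measure \<nu> (space \<nu>)"

text \<open>\<open>has_cond_law M F N X K\<close>: the random element \<open>X\<close> of \<open>N\<close> has conditional law \<open>K\<close>
  given the sigma-field \<open>F\<close>. For the zero measure (excluded almost surely in the urn scheme)
  \<open>normalized\<close> returns zero, so \<open>K\<close> is not required to be a probability everywhere.\<close>

definition has_cond_law ::
    "'w measure \<Rightarrow> 'w measure \<Rightarrow> 'b measure \<Rightarrow> ('w \<Rightarrow> 'b) \<Rightarrow> ('w \<Rightarrow> 'b measure) \<Rightarrow> bool" where
  "has_cond_law M F N X K \<longleftrightarrow>
     (\<forall>A\<in>sets N. AE \<omega> in M.
        real_cond_exp M F (\<lambda>\<omega>. indicator A (X \<omega>)) \<omega> = measure (K \<omega>) A)"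

text \<open>\<open>urn_history S M U \<sigma> C \<xi> n m\<close> is the sigma-field generated by \<open>U k\<close> for \<open>k \<le> n\<close>,
  \<open>(C k, \<xi> k)\<close> for \<open>1 \<le> k \<le> n\<close> and the colors \<open>\<sigma> k\<close> for \<open>k < m\<close>. The history up to step \<open>n\<close>
  is the case \<open>m = n\<close>, and \<open>m = n + 1\<close> adds the color \<open>\<sigma> n\<close> to it.\<close>

definition urn_history ::
    "'a measure \<Rightarrow> 'w measure \<Rightarrow> (nat \<Rightarrow> 'w \<Rightarrow> 'a measure) \<Rightarrow> (nat \<Rightarrow> 'w \<Rightarrow> 'a) \<Rightarrow>
     (nat \<Rightarrow> 'w \<Rightarrow> int) \<Rightarrow> (nat \<Rightarrow> 'w \<Rightarrow> 'a measure) \<Rightarrow> nat \<Rightarrow> nat \<Rightarrow> 'w measure" where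
  "urn_history S M U \<sigma> C \<xi> n m = sigma (space M)
      ({U k -` A \<inter> space M | k A. k \<le> n \<and> A \<in> sets (counting_space S)}
       \<union> {(\<lambda>\<omega>. (C k \<omega>, \<xi> k \<omega>)) -` A \<inter> space M | k A.
            1 \<le> k \<and> k \<le> n \<and> A \<in> sets (replacement_space S)}
       \<union> {\<sigma> k -` A \<inter> space M | k A. k < m \<and> A \<in> sets S})"

text \<open>The recursion is only required almost surely: if \<open>C (Suc n) = -1\<close> then
  \<open>U n + C (Suc n) \<delta>\<close> with \<open>\<delta>\<close> the Dirac mass at \<open>\<sigma> n\<close> is a measure only if \<open>\<sigma> n\<close> is an atom
  of \<open>U n\<close>. The values \<open>C 0\<close> and \<open>\<xi> 0\<close> are never used.\<close>

locale urn_scheme = prob_space M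
  for S :: "'a measure" and P :: "'a \<Rightarrow> (int \<times> 'a measure) measure" and u\<^sub>0 :: "'a measure"
    and M :: "'w measure" and U :: "nat \<Rightarrow> 'w \<Rightarrow> 'a measure" and \<sigma> :: "nat \<Rightarrow> 'w \<Rightarrow> 'a"
    and C :: "nat \<Rightarrow> 'w \<Rightarrow> int" and \<xi> :: "nat \<Rightarrow> 'w \<Rightarrow> 'a measure" +
  assumes U_measurable: "\<And>n. U n \<in> measurable M (counting_space S)"
    and color_measurable: "\<And>n. \<sigma> n \<in> measurable M S"
    and replacement_measurable:
      "\<And>n. (\<lambda>\<omega>. (C (Suc n) \<omega>, \<xi> (Suc n) \<omega>)) \<in> measurable M (replacement_space S)"
    and initial: "AE \<omega> in M. U 0 \<omega> = u\<^sub>0"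
    and color_law:
      "\<And>n. has_cond_law M (urn_history S M U \<sigma> C \<xi> n n) S (\<sigma> n) (\<lambda>\<omega>. normalized (U n \<omega>))"
    and replacement_law:
      "\<And>n. has_cond_law M (urn_history S M U \<sigma> C \<xi> n (Suc n)) (replacement_space S)
         (\<lambda>\<omega>. (C (Suc n) \<omega>, \<xi> (Suc n) \<omega>)) (\<lambda>\<omega>. P (\<sigma> n \<omega>))"
    and recursion:
      "\<And>n. AE \<omega> in M. \<forall>A\<in>sets S. measure (U (Suc n) \<omega>) A =
         measure (U n \<omega>) A + real_of_int (C (Suc n) \<omega>) * indicator A (\<sigma> n \<omega>)
           + measure (\<xi> (Suc n) \<omega>) A"

end

theory Submission
  imports Defs
begin

text \<open>Stochastic approximation. Fix a bounded \<open>g\<close> with \<open>\<mu>(g) = 0\<close>, let \<open>T n\<close> be the total mass of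
  \<open>U n\<close>, and let \<open>y n\<close> be the average of \<open>g\<close> under the normalized \<open>U n\<close>. Given the past, \<open>U n (g)\<close> has
  drift \<open>E(C) y n\<close> and \<open>T n\<close> has drift \<open>E(C) + b n\<close>, where \<open>b n\<close> is \<open>\<mu>(1)\<close> times the average of \<open>a\<close> and
  hence is bounded away from \<open>0\<close>. The terms with \<open>E(C)\<close> cancel in the quotient, which leaves
  \<open>y (n + 1) = (1 - b n / T n) y n + noise\<close>. Since \<open>T n\<close> lies between two positive multiples of \<open>n\<close>, the
  steps \<open>b n / T n\<close> have infinite sum while the noise is summable by the convergence theorem for
  \<open>L\<^sup>2\<close> martingales, so \<open>y n\<close> tends to \<open>0\<close>. Taking \<open>a\<close> as test function then gives the drift of \<open>T n\<close>
  in the limit, and with it the limit of \<open>T n / n\<close>.\<close>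

subsection \<open>Perturbed linear recursions\<close>

text \<open>The obstacle is the random denominator. The quotient recursion divides by
  \<open>T (Suc n)\<close>, which is unknown at time \<open>n\<close>, so the noise over it is not a
  martingale difference. Replacing it by \<open>T n\<close> costs a remainder quadratic in the jump,
  which uniformly bounded second moments make summable. Moreover \<open>1 / T n\<close> is of order
  1/n only almost surely and from a random time on, whereas the variance bound wants a deterministic
  estimate; the weights are therefore truncated, and agree with \<open>1 / T n\<close> eventually.
  The linear lower bound for \<open>T n\<close> counts the jumps of size at least 1, each of
  conditional probability at least \<delta>. Only the second moment of the sum of C and the mass of
  \<xi> is controlled. Since C \<ge> -1, the sum of |C| and this mass exceeds |X| by at most 2, so
  the two parts are controlled separately as well. Every conditional expectation is taken in two
  stages, given the color and then over the color.\<close>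

lemma contraction_tendsto_zero:
  fixes z \<beta> :: "nat \<Rightarrow> real"
  assumes z: "\<And>n. 0 \<le> z n" and rec: "\<And>n. N \<le> n \<Longrightarrow> z (Suc n) \<le> (1 - \<beta> n) * z n"
    and \<beta>: "\<And>n. N \<le> n \<Longrightarrow> 0 \<le> \<beta> n" and div: "\<not> summable \<beta>"
  shows "z \<longlonglongrightarrow> 0"
proof -
  have bound: "z (N + k) \<le> z N * exp (- (\<Sum>i<k. \<beta> (i + N)))" for k
  proof (induction k)
    case (Suc k)
    have "z (N + Suc k) \<le> (1 - \<beta> (N + k)) * z (N + k)" using rec[of "N + k"] by simp
    \<comment> \<open>Multiplying 1 - x \<le> exp (-x) by \<open>z (N + k)\<close> uses only that
      \<open>z\<close> is nonnegative, so the factor 1 - \<beta> may have either sign.\<close>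
    also have "\<dots> \<le> exp (- \<beta> (N + k)) * z (N + k)"
      using exp_ge_add_one_self[of "- \<beta> (N + k)"] z by (intro mult_right_mono) auto
    also have "\<dots> \<le> exp (- \<beta> (N + k)) * (z N * exp (- (\<Sum>i<k. \<beta> (i + N))))"
      using Suc by (intro mult_left_mono) auto
    also have "\<dots> = z N * exp (- (\<Sum>i<Suc k. \<beta> (i + N)))"
      by (simp add: exp_add[symmetric] exp_diff exp_minus field_simps)
    finally show ?case .
  qed simp
  have nsum: "\<not> summable (\<lambda>i. \<beta> (i + N))" using div by (simp add: summable_iff_shift)
  have "filterlim (\<lambda>k. \<Sum>i<k. \<beta> (i + N)) at_top sequentially"
    unfolding filterlim_at_top
  proof
    fix Z
    obtain k where k: "Z < (\<Sum>i<k. \<beta> (i + N))"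
      using summableI_nonneg_bounded[of "\<lambda>i. \<beta> (i + N)" Z] \<beta> nsum
      by (meson le_add2 not_le_imp_less)
    have "Z \<le> (\<Sum>i<m. \<beta> (i + N))" if "k \<le> m" for m
      using sum_mono2[of "{..<m}" "{..<k}" "\<lambda>i. \<beta> (i + N)"] that k \<beta> by fastforce
    then show "\<forall>\<^sub>F m in sequentially. Z \<le> (\<Sum>i<m. \<beta> (i + N))"
      unfolding eventually_sequentially by blast
  qed
  then have "(\<lambda>k. exp (- (\<Sum>i<k. \<beta> (i + N)))) \<longlonglongrightarrow> 0"
    by (intro filterlim_compose[OF exp_at_bot] filterlim_compose[OF filterlim_uminus_at_bot_at_top])
  from tendsto_mult_right_zero[OF this, of "z N"]
  have "(\<lambda>k. z (N + k)) \<longlonglongrightarrow> 0"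
    by (rule tendsto_sandwich[OF _ _ tendsto_const, rotated 2]) (use bound z in auto)
  then show ?thesis by (simp add: LIMSEQ_offset add.commute)
qed

text \<open>Adding the tail sum \<open>r n\<close> of the noise to \<open>y n\<close> absorbs
  \<epsilon>: the new sequence \<open>w\<close> satisfies the recursion with error
  \<open>\<beta> n * (r n + e n)\<close>. All perturbations then carry the factor \<beta> of the
  contraction, and what they multiply tends to 0.\<close>

lemma perturbed_contraction_tendsto_zero:
  fixes y \<beta> \<epsilon> e :: "nat \<Rightarrow> real"
  assumes rec: "\<forall>\<^sub>F n in sequentially. y (Suc n) = (1 - \<beta> n) * y n + \<epsilon> n + \<beta> n * e n"
    and \<beta>: "\<forall>\<^sub>F n in sequentially. 0 \<le> \<beta> n \<and> \<beta> n \<le> 1" and div: "\<not> summable \<beta>"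
    and \<epsilon>: "summable \<epsilon>" and e: "e \<longlonglongrightarrow> 0"
  shows "y \<longlonglongrightarrow> 0"
proof -
  define r where "r n = (\<Sum>k. \<epsilon> (k + n))" for n
  define w where "w n = y n + r n" for n
  have r: "r \<longlonglongrightarrow> 0"
    using suminf_exist_split2[OF \<epsilon>] by (simp add: r_def[abs_def])
  have r_Suc: "r n = \<epsilon> n + r (Suc n)" for n
    using suminf_split_head[of "\<lambda>k. \<epsilon> (k + n)"] \<epsilon> by (simp add: r_def summable_iff_shift)
  have "w \<longlonglongrightarrow> 0"
  proof (rule LIMSEQ_I)
    fix \<eta> :: real assume "0 < \<eta>"
    then have h: "0 < \<eta> / 2" by simp
    have "(\<lambda>n. r n + e n) \<longlonglongrightarrow> 0" using tendsto_add[OF r e] by simp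
    from order_tendstoD(2)[OF tendsto_rabs_zero[OF this] h] rec \<beta>
    have "\<forall>\<^sub>F n in sequentially. \<bar>r n + e n\<bar> < \<eta> / 2 \<and> 0 \<le> \<beta> n \<and> \<beta> n \<le> 1 \<and>
       y (Suc n) = (1 - \<beta> n) * y n + \<epsilon> n + \<beta> n * e n"
      by eventually_elim auto
    then obtain N where N: "\<And>n. n \<ge> N \<Longrightarrow> \<bar>r n + e n\<bar> < \<eta> / 2" "\<And>n. n \<ge> N \<Longrightarrow> 0 \<le> \<beta> n"
      "\<And>n. n \<ge> N \<Longrightarrow> \<beta> n \<le> 1" "\<And>n. n \<ge> N \<Longrightarrow> y (Suc n) = (1 - \<beta> n) * y n + \<epsilon> n + \<beta> n * e n"
      unfolding eventually_sequentially by blast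
    \<comment> \<open>The level \<eta>/2 is fixed by the map x to (1 - \<beta>) x + \<beta>
      \<eta>/2. Once the error is below \<eta>/2, the excess of |w| over this level therefore
      contracts by the factor 1 - \<beta>.\<close>
    define z where "z n = max 0 (\<bar>w n\<bar> - \<eta> / 2)" for n
    have "z \<longlonglongrightarrow> 0"
    proof (rule contraction_tendsto_zero[where N=N and \<beta>=\<beta>])
      fix n assume n: "N \<le> n"
      have "w (Suc n) = (1 - \<beta> n) * w n + \<beta> n * (r n + e n)"
        using N(4)[OF n] r_Suc[of n] by (simp add: w_def algebra_simps)
      then have "\<bar>w (Suc n)\<bar> \<le> (1 - \<beta> n) * \<bar>w n\<bar> + \<beta> n * \<bar>r n + e n\<bar>"
        using N(2,3)[OF n] by (auto simp: abs_mult intro!: order_trans[OF abs_triangle_ineq])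
      also have "\<dots> \<le> (1 - \<beta> n) * \<bar>w n\<bar> + \<beta> n * (\<eta> / 2)"
        using N(1,2)[OF n] by (intro add_left_mono mult_left_mono) auto
      finally have "\<bar>w (Suc n)\<bar> - \<eta> / 2 \<le> (1 - \<beta> n) * (\<bar>w n\<bar> - \<eta> / 2)"
        by (simp add: algebra_simps add_divide_distrib diff_divide_distrib)
      also have "\<dots> \<le> (1 - \<beta> n) * z n"
        using N(3)[OF n] by (intro mult_left_mono) (auto simp: z_def)
      finally show "z (Suc n) \<le> (1 - \<beta> n) * z n"
        using N(3)[OF n] by (auto simp: z_def)
    qed (use N div in \<open>auto simp: z_def\<close>)
    from order_tendstoD(2)[OF this h] obtain N' where "\<And>n. n \<ge> N' \<Longrightarrow> z n < \<eta> / 2"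
      unfolding eventually_sequentially by blast
    then have "\<bar>w n\<bar> < \<eta>" if "n \<ge> N'" for n
      using \<open>\<And>n. n \<ge> N' \<Longrightarrow> z n < \<eta> / 2\<close>[OF that] unfolding z_def by linarith
    then show "\<exists>N. \<forall>n\<ge>N. norm (w n - 0) < \<eta>" by auto
  qed
  from tendsto_diff[OF this r] show ?thesis by (simp add: w_def)
qed

section \<open>Averages and Kronecker's lemma\<close>

lemma not_summable_inverse_Suc: "\<not> summable (\<lambda>n. c / real (Suc n))" if "c \<noteq> 0"
proof
  assume "summable (\<lambda>n. c / real (Suc n))"
  from summable_mult[OF this, of "1/c"] that have "summable (\<lambda>n. 1 / real (Suc n))" by simp
  then have "summable (\<lambda>n. inverse (real n))"
    by (subst summable_Suc_iff[symmetric]) (simp add: inverse_eq_divide)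
  then show False using not_summable_harmonic[where 'a=real] by simp
qed

text \<open>A running average is itself a perturbed contraction with step 1/(n + 1), and the noise
  is the n-th term of the series assumed summable.\<close>

lemma kronecker_average:
  fixes x :: "nat \<Rightarrow> real"
  assumes "summable (\<lambda>n. x n / real (Suc n))"
  shows "(\<lambda>n. (\<Sum>k<n. x k) / real n) \<longlonglongrightarrow> 0"
proof (rule perturbed_contraction_tendsto_zero[where \<epsilon>="\<lambda>n. x n / real (Suc n)"
      and \<beta>="\<lambda>n. 1 / real (Suc n)" and e="\<lambda>_. 0"])
  show "\<forall>\<^sub>F n in sequentially. (\<Sum>k<Suc n. x k) / real (Suc n) =
     (1 - 1 / real (Suc n)) * ((\<Sum>k<n. x k) / real n) + x n / real (Suc n) + 1 / real (Suc n) * 0"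
    using eventually_gt_at_top[of 0]
    by eventually_elim (simp add: field_simps del: of_nat_Suc, simp add: algebra_simps)
qed (use assms not_summable_inverse_Suc[of 1] in auto)

text \<open>The deviation of \<open>x n / n\<close> from \<open>L\<close> is a contraction with step
  1/(n + 1): the noise enters summably, and \<open>r n - L\<close> enters with the factor of the
  step. It yields the growth rate of the total mass.\<close>

lemma recursion_average:
  fixes x r D :: "nat \<Rightarrow> real"
  assumes rec: "\<And>n. x (Suc n) = x n + D n + r n"
    and D: "summable (\<lambda>n. D n / real (Suc n))" and r: "r \<longlonglongrightarrow> L"
  shows "(\<lambda>n. x n / real n) \<longlonglongrightarrow> L"
proof -
  have average_step: "(x + D + r) / s - L = (x - (s - 1) * L) / s + D / s + 1 / s * (r - L)"
    if "s \<noteq> 0" for s x D r :: real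
    using that by (simp add: field_simps)
  have "(\<lambda>n. x n / real n - L) \<longlonglongrightarrow> 0"
  proof (rule perturbed_contraction_tendsto_zero[where \<epsilon>="\<lambda>n. D n / real (Suc n)"
        and \<beta>="\<lambda>n. 1 / real (Suc n)" and e="\<lambda>n. r n - L"])
    show "\<forall>\<^sub>F n in sequentially. x (Suc n) / real (Suc n) - L = (1 - 1 / real (Suc n)) * (x n / real n - L)
        + D n / real (Suc n) + 1 / real (Suc n) * (r n - L)"
      \<comment> \<open>At n = 0 the quotient \<open>x 0 / real 0\<close> is 0 by convention and
        loses the initial value, so the recursion is claimed for positive n only.\<close>
      using eventually_gt_at_top[of 0]
    proof eventually_elim
      fix n :: nat assume "0 < n"
      then have "(1 - 1 / real (Suc n)) * (x n / real n - L) = (x n - n * L) / real (Suc n)"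
        by (simp add: field_simps del: of_nat_Suc, simp add: algebra_simps)
      then show "x (Suc n) / real (Suc n) - L = (1 - 1 / real (Suc n)) * (x n / real n - L)
          + D n / real (Suc n) + 1 / real (Suc n) * (r n - L)"
        using average_step[of "real (Suc n)" "x n" "D n" "r n"] by (simp add: rec)
    qed
  qed (use D not_summable_inverse_Suc[of 1] r in \<open>auto simp: LIM_zero_iff\<close>)
  then show ?thesis by (simp add: LIM_zero_iff)
qed

text \<open>This is the deterministic half of the argument, to be applied along almost every path.
  The noise is summable over \<open>T n\<close>, the denominator known at time \<open>n\<close>,
  whereas the recursion has \<open>T (Suc n)\<close>; \<open>increment_le\<close> and
  \<open>X_sq\<close> pay for the exchange.\<close>

lemma recursion_ratio_tendsto_zero:
  fixes y T X N b :: "nat \<Rightarrow> real"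
  assumes T_pos: "\<And>n. 0 < T n" and T_Suc: "\<And>n. T (Suc n) = T n + X n" and X: "\<And>n. 0 \<le> X n"
    and y: "\<And>n. y (Suc n) = y n + (N n - b n * y n) / T (Suc n)"
    and increment_le: "\<And>n. \<bar>N n - b n * y n\<bar> \<le> L * (X n + 2)"
    and b: "\<And>n. b0 \<le> b n" "\<And>n. b n \<le> b1" "0 < b0"
    and lower: "\<forall>\<^sub>F n in sequentially. \<kappa> * real (Suc n) \<le> T n" and \<kappa>: "0 < \<kappa>"
    and upper: "\<forall>\<^sub>F n in sequentially. T n \<le> K * real (Suc n)"
    and N: "summable (\<lambda>n. N n / T n)"
    and X_sq: "summable (\<lambda>n. (X n + 2)\<^sup>2 / (real (Suc n))\<^sup>2)"
  shows "y \<longlonglongrightarrow> 0"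
proof -
  \<comment> \<open>The error of replacing \<open>T (Suc n)\<close> by \<open>T n\<close>, from 1/T
    - 1/(T + X) = X/(T (T + X)). The increment is at most a multiple of X + 2 and both denominators
    are at least \<kappa> (n + 1), so \<open>R n\<close> is of order (X + 2)^2/(n + 1)^2.\<close>
  define R where "R n = (N n - b n * y n) * X n / (T n * T (Suc n))" for n
  have L: "0 \<le> L"
  proof -
    have "0 \<le> L * (X 0 + 2)" by (rule order_trans[OF abs_ge_zero increment_le])
    then show ?thesis using X[of 0] by (simp add: zero_le_mult_iff)
  qed
  have R: "summable R"
  proof (rule summable_comparison_test_ev)
    show "summable (\<lambda>n. L / \<kappa>\<^sup>2 * ((X n + 2)\<^sup>2 / (real (Suc n))\<^sup>2))"
      by (intro summable_mult X_sq)
    show "\<forall>\<^sub>F n in sequentially. norm (R n) \<le> L / \<kappa>\<^sup>2 * ((X n + 2)\<^sup>2 / (real (Suc n))\<^sup>2)"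
      using lower
    proof eventually_elim
      fix n assume low: "\<kappa> * real (Suc n) \<le> T n"
      have pos: "0 < \<kappa> * real (Suc n)" using \<kappa> by simp
      have "norm (R n) = \<bar>N n - b n * y n\<bar> * X n / (T n * T (Suc n))"
        using X[of n] T_pos[of n] T_pos[of "Suc n"] by (simp add: R_def abs_mult)
      also have "\<dots> \<le> (L * (X n + 2) * (X n + 2)) / ((\<kappa> * real (Suc n)) * (\<kappa> * real (Suc n)))"
        using X[of n] L low pos T_Suc[of n] increment_le[of n] \<kappa>
          less_imp_le[OF T_pos[of n]]
        by (intro frac_le mult_mono mult_pos_pos mult_nonneg_nonneg) auto
      finally show "norm (R n) \<le> L / \<kappa>\<^sup>2 * ((X n + 2)\<^sup>2 / (real (Suc n))\<^sup>2)"
        by (simp add: power2_eq_square mult_ac)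
    qed
  qed
  show ?thesis
  proof (rule perturbed_contraction_tendsto_zero[where \<epsilon>="\<lambda>n. N n / T n - R n"
        and \<beta>="\<lambda>n. b n / T n" and e="\<lambda>n. 0"])
    show "\<forall>\<^sub>F n in sequentially. y (Suc n) = (1 - b n / T n) * y n + (N n / T n - R n) + b n / T n * 0"
    proof (intro always_eventually allI)
      fix n
      have "(N n - b n * y n) / T (Suc n) = (N n - b n * y n) / T n - R n"
        using T_pos[of n] T_pos[of "Suc n"] by (simp add: R_def T_Suc divide_simps) (simp add: algebra_simps)
      then show "y (Suc n) = (1 - b n / T n) * y n + (N n / T n - R n) + b n / T n * 0"
        unfolding y by (simp add: algebra_simps diff_divide_distrib)
    qed
    have "\<forall>\<^sub>F n in sequentially. b1 / \<kappa> \<le> real (Suc n)"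
      by (intro filterlim_at_top[THEN iffD1, rule_format] filterlim_compose[OF filterlim_real_sequentially filterlim_Suc])
    with lower show "\<forall>\<^sub>F n in sequentially. 0 \<le> b n / T n \<and> b n / T n \<le> 1"
    proof eventually_elim
      fix n assume "\<kappa> * real (Suc n) \<le> T n" "b1 / \<kappa> \<le> real (Suc n)"
      then have "b n \<le> T n"
        using b(2)[of n] \<kappa> by (simp add: pos_divide_le_eq mult.commute)
      then show "0 \<le> b n / T n \<and> b n / T n \<le> 1"
        using b(1)[of n] b(3) T_pos[of n] by simp
    qed
    have "eventually (\<lambda>n. 0 < K) sequentially"
      using upper
    proof eventually_elim
      fix n assume "T n \<le> K * real (Suc n)"
      then have "0 < K * real (Suc n)" using T_pos[of n] by linarith
      then show "0 < K" by (simp add: zero_less_mult_iff)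
    qed
    then have K: "0 < K" by simp
    show "\<not> summable (\<lambda>n. b n / T n)"
    proof
      assume "summable (\<lambda>n. b n / T n)"
      then have "summable (\<lambda>n. (b0 / K) / real (Suc n))"
      proof (rule summable_comparison_test_ev[rotated])
        show "\<forall>\<^sub>F n in sequentially. norm ((b0 / K) / real (Suc n)) \<le> b n / T n"
          using upper
        proof eventually_elim
          fix n assume "T n \<le> K * real (Suc n)"
          then have "b0 / (K * real (Suc n)) \<le> b n / T n"
            using b(1)[of n] b(3) T_pos[of n] by (intro frac_le) auto
          then show "norm ((b0 / K) / real (Suc n)) \<le> b n / T n"
            using b(3) K by simp
        qed
      qed
      with not_summable_inverse_Suc[of "b0 / K"] b(3) K show False by simp
    qed
  qed (use N R in \<open>auto intro: summable_diff\<close>)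
qed

subsection \<open>Convergence of square-integrable martingales\<close>

lemma (in prob_space) sigma_finite_subalgebra: "subalgebra M F \<Longrightarrow> sigma_finite_subalgebra M F"
  by (intro finite_measure_subalgebra_is_sigma_finite finite_measure_subalgebra.intro
      finite_measure_subalgebra_axioms.intro finite_measure_axioms)

lemma integrable_mult_of_square:
  fixes X Y :: "'a \<Rightarrow> real"
  assumes [measurable]: "X \<in> borel_measurable M" "Y \<in> borel_measurable M"
    and "integrable M (\<lambda>\<omega>. (X \<omega>)\<^sup>2)" "integrable M (\<lambda>\<omega>. (Y \<omega>)\<^sup>2)"
  shows "integrable M (\<lambda>\<omega>. X \<omega> * Y \<omega>)"
proof (rule Bochner_Integration.integrable_bound[OF Bochner_Integration.integrable_add[OF assms(3,4)]])
  show "AE \<omega> in M. norm (X \<omega> * Y \<omega>) \<le> norm ((X \<omega>)\<^sup>2 + (Y \<omega>)\<^sup>2)"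
  proof (rule AE_I2)
    fix \<omega>
    have "2 * (\<bar>X \<omega>\<bar> * \<bar>Y \<omega>\<bar>) \<le> (X \<omega>)\<^sup>2 + (Y \<omega>)\<^sup>2" "0 \<le> \<bar>X \<omega>\<bar> * \<bar>Y \<omega>\<bar>"
      using zero_le_power2[of "\<bar>X \<omega>\<bar> - \<bar>Y \<omega>\<bar>"] by (auto simp: power2_diff mult.assoc)
    then show "norm (X \<omega> * Y \<omega>) \<le> norm ((X \<omega>)\<^sup>2 + (Y \<omega>)\<^sup>2)"
      unfolding abs_mult real_norm_def by linarith
  qed
qed simp

lemma integrable_square_add:
  fixes X Y :: "'a \<Rightarrow> real"
  assumes [measurable]: "X \<in> borel_measurable M" "Y \<in> borel_measurable M"
    and "integrable M (\<lambda>\<omega>. (X \<omega>)\<^sup>2)" "integrable M (\<lambda>\<omega>. (Y \<omega>)\<^sup>2)"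
  shows "integrable M (\<lambda>\<omega>. (X \<omega> + Y \<omega>)\<^sup>2)"
  using assms integrable_mult_of_square[OF assms]
  by (auto simp: power2_sum mult.assoc)

lemma summable_inverse_square_Suc: "summable (\<lambda>n. 1 / (real (Suc n))\<^sup>2)"
  using inverse_power_summable[of 2, where 'a=real]
    summable_Suc_iff[of "\<lambda>n. 1 / (real n)\<^sup>2"] by (simp add: inverse_eq_divide)

locale martingale_differences = prob_space M for M :: "'w measure" +
  fixes F :: "nat \<Rightarrow> 'w measure" and D :: "nat \<Rightarrow> 'w \<Rightarrow> real"
  assumes sub: "\<And>n. subalgebra M (F n)"
    and filtration: "\<And>m n. m \<le> n \<Longrightarrow> subalgebra (F n) (F m)"
    and adapted: "\<And>n. D n \<in> borel_measurable (F (Suc n))"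
    and square_integrable: "\<And>n. integrable M (\<lambda>\<omega>. (D n \<omega>)\<^sup>2)"
    and centered: "\<And>n. AE \<omega> in M. real_cond_exp M (F n) (D n) \<omega> = 0"
begin

lemma measurable_D [measurable]: "D n \<in> borel_measurable M"
  using adapted sub by (rule measurable_from_subalg[rotated])

lemma measurable_D_later: "k < n \<Longrightarrow> D k \<in> borel_measurable (F n)"
  using measurable_from_subalg[OF filtration[of "Suc k" n] adapted[of k]] by simp

lemma measurable_partial_sum: "j \<le> n \<Longrightarrow> (\<lambda>\<omega>. \<Sum>k<j. D k \<omega>) \<in> borel_measurable (F n)"
  by (intro borel_measurable_sum measurable_D_later) auto

lemma sigma_finite_F: "sigma_finite_subalgebra M (F n)"
  by (rule sigma_finite_subalgebra[OF sub])

lemma predictable_integral_zero: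
  assumes "W \<in> borel_measurable (F n)" "integrable M (\<lambda>\<omega>. W \<omega> * D n \<omega>)"
  shows "(\<integral>\<omega>. W \<omega> * D n \<omega> \<partial>M) = 0"
proof -
  interpret sigma_finite_subalgebra M "F n" by (rule sigma_finite_F)
  have "(\<integral>\<omega>. W \<omega> * D n \<omega> \<partial>M) = (\<integral>\<omega>. W \<omega> * real_cond_exp M (F n) (D n) \<omega> \<partial>M)"
    using real_cond_exp_intg(2)[OF assms(2,1)] by simp
  also have "\<dots> = (\<integral>\<omega>. 0 \<partial>M)"
    using measurable_from_subalg[OF sub assms(1)] centered[of n] by (intro integral_cong_AE) auto
  finally show ?thesis by simp
qed

text \<open>Chebyshev's inequality is applied to the partial sums stopped when they leave
  \<open>(-\<epsilon>, \<epsilon>)\<close>: at time \<open>n\<close> these are still outside if the original ones ever were.\<close>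

lemma maximal_inequality:
  assumes "0 < \<epsilon>"
  shows "prob {\<omega>\<in>space M. \<exists>j\<le>n. \<epsilon> \<le> \<bar>\<Sum>k<j. D k \<omega>\<bar>} \<le> (\<Sum>k<n. \<integral>\<omega>. (D k \<omega>)\<^sup>2 \<partial>M) / \<epsilon>\<^sup>2"
proof -
  \<comment> \<open>\<open>B k\<close> says that no exit has occurred up to time k, which is known
    at time k. The increment leading to the exit is thus kept and all later ones are dropped, so
    \<open>S'\<close> freezes at the first partial sum outside the interval.\<close>
  define B :: "nat \<Rightarrow> 'w \<Rightarrow> real" where
    "B k \<omega> = (if \<forall>j\<in>{..k}. \<bar>\<Sum>i<j. D i \<omega>\<bar> < \<epsilon> then 1 else 0)" for k \<omega>
  define S' where "S' n \<omega> = (\<Sum>k<n. B k \<omega> * D k \<omega>)" for n \<omega>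
  have B_F: "B k \<in> borel_measurable (F n)" if "k \<le> n" for k n
  proof -
    have "Measurable.pred (F n) (\<lambda>\<omega>. \<bar>\<Sum>i<j. D i \<omega>\<bar> < \<epsilon>)" if "j \<in> {..k}" for j
    proof -
      have [measurable]: "(\<lambda>\<omega>. \<Sum>i<j. D i \<omega>) \<in> borel_measurable (F n)"
        using that \<open>k \<le> n\<close> by (intro measurable_partial_sum) auto
      show ?thesis by measurable
    qed
    then have "Measurable.pred (F n) (\<lambda>\<omega>. \<forall>j\<in>{..k}. \<bar>\<Sum>i<j. D i \<omega>\<bar> < \<epsilon>)"
      by (intro pred_intros_finite) auto
    then show ?thesis unfolding B_def[abs_def] by measurable
  qed
  have S'_F: "S' n \<in> borel_measurable (F n)" for n
    unfolding S'_def[abs_def] using B_F measurable_D_later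
    by (intro borel_measurable_sum borel_measurable_times) auto
  have [measurable]: "B k \<in> borel_measurable M" "S' k \<in> borel_measurable M" for k
    using measurable_from_subalg[OF sub B_F[OF order_refl]] measurable_from_subalg[OF sub S'_F] by auto
  have BD: "integrable M (\<lambda>\<omega>. (B k \<omega> * D k \<omega>)\<^sup>2)" for k
    by (rule Bochner_Integration.integrable_bound[OF square_integrable[of k]]) (auto simp: B_def)
  have S'_int: "integrable M (\<lambda>\<omega>. (S' n \<omega>)\<^sup>2)" for n
  proof (induction n)
    case (Suc n)
    have "integrable M (\<lambda>\<omega>. (S' n \<omega> + B n \<omega> * D n \<omega>)\<^sup>2)"
      by (intro integrable_square_add Suc BD) auto
    then show ?case by (simp add: S'_def)
  qed (simp add: S'_def)
  have S'_le: "(\<integral>\<omega>. (S' n \<omega>)\<^sup>2 \<partial>M) \<le> (\<Sum>k<n. \<integral>\<omega>. (D k \<omega>)\<^sup>2 \<partial>M)" for n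
  proof (induction n)
    case (Suc n)
    \<comment> \<open>The factor \<open>S' n * B n\<close> is known at time n, so the cross term of
      the square has mean 0; this is what makes the second moments add up.\<close>
    have cross: "integrable M (\<lambda>\<omega>. S' n \<omega> * (B n \<omega> * D n \<omega>))"
      by (intro integrable_mult_of_square S'_int BD) auto
    then have zero: "(\<integral>\<omega>. S' n \<omega> * (B n \<omega> * D n \<omega>) \<partial>M) = 0"
      using predictable_integral_zero[of "\<lambda>\<omega>. S' n \<omega> * B n \<omega>" n] S'_F[of n] B_F[OF order_refl, of n]
      by (simp add: mult.assoc)
    have "(\<integral>\<omega>. (S' (Suc n) \<omega>)\<^sup>2 \<partial>M) =
        (\<integral>\<omega>. (S' n \<omega>)\<^sup>2 + (B n \<omega> * D n \<omega>)\<^sup>2 + 2 * (S' n \<omega> * (B n \<omega> * D n \<omega>)) \<partial>M)"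
      by (simp add: S'_def power2_sum mult.assoc)
    also have "\<dots> = (\<integral>\<omega>. (S' n \<omega>)\<^sup>2 \<partial>M) + (\<integral>\<omega>. (B n \<omega> * D n \<omega>)\<^sup>2 \<partial>M)"
      using S'_int[of n] BD[of n] cross zero by simp
    also have "\<dots> \<le> (\<integral>\<omega>. (S' n \<omega>)\<^sup>2 \<partial>M) + (\<integral>\<omega>. (D n \<omega>)\<^sup>2 \<partial>M)"
      by (intro add_left_mono integral_mono BD square_integrable) (auto simp: B_def)
    finally show ?case using Suc by simp
  qed (simp add: S'_def)
  have stopped: "\<epsilon> \<le> \<bar>S' n \<omega>\<bar>" if "\<exists>j\<le>n. \<epsilon> \<le> \<bar>\<Sum>k<j. D k \<omega>\<bar>" for \<omega>
  proof -
    define j where "j = (LEAST j. \<epsilon> \<le> \<bar>\<Sum>k<j. D k \<omega>\<bar>)"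
    have j: "\<epsilon> \<le> \<bar>\<Sum>k<j. D k \<omega>\<bar>" "j \<le> n" and least: "\<And>i. i < j \<Longrightarrow> \<bar>\<Sum>k<i. D k \<omega>\<bar> < \<epsilon>"
      using that LeastI_ex[of "\<lambda>j. \<epsilon> \<le> \<bar>\<Sum>k<j. D k \<omega>\<bar>"] Least_le[of "\<lambda>j. \<epsilon> \<le> \<bar>\<Sum>k<j. D k \<omega>\<bar>"]
        not_less_Least[of _ "\<lambda>j. \<epsilon> \<le> \<bar>\<Sum>k<j. D k \<omega>\<bar>"]
      by (auto simp: j_def not_le intro: le_trans)
    have "S' n \<omega> = (\<Sum>k<j. B k \<omega> * D k \<omega>)"
    proof -
      have "B i \<omega> = 0" if "j \<le> i" for i
        using j(1) that by (auto simp: B_def not_less intro: bexI[of _ j])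
      then show ?thesis
        unfolding S'_def using j(2) by (intro sum.mono_neutral_right) auto
    qed
    also have "\<dots> = (\<Sum>k<j. D k \<omega>)"
      using least by (intro sum.cong) (auto simp: B_def)
    finally show ?thesis using j by simp
  qed
  have "prob {\<omega>\<in>space M. \<exists>j\<le>n. \<epsilon> \<le> \<bar>\<Sum>k<j. D k \<omega>\<bar>} \<le> prob {\<omega>\<in>space M. \<epsilon>\<^sup>2 \<le> (S' n \<omega>)\<^sup>2}"
    using stopped \<open>0 < \<epsilon>\<close> by (intro finite_measure_mono) (auto simp: abs_le_square_iff[symmetric])
  also have "\<dots> \<le> (\<integral>\<omega>. (S' n \<omega>)\<^sup>2 \<partial>M) / \<epsilon>\<^sup>2"
    using S'_int \<open>0 < \<epsilon>\<close> by (intro integral_Markov_inequality_measure[where A="{}"]) auto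
  also have "\<dots> \<le> (\<Sum>k<n. \<integral>\<omega>. (D k \<omega>)\<^sup>2 \<partial>M) / \<epsilon>\<^sup>2"
    by (intro divide_right_mono S'_le) auto
  finally show ?thesis .
qed

lemma shifted: "martingale_differences M (\<lambda>n. F (n + m)) (\<lambda>n. D (n + m))"
  using adapted centered by unfold_locales (auto intro: sub filtration square_integrable)

text \<open>By the maximal inequality for the shifted sequence, an excursion of size \<epsilon>
  after time m has probability at most the tail of the variances over \<epsilon>^2, which tends to 0
  in m. Almost surely some m is thus free of such excursions, for each \<epsilon> = 1/(i + 1), and
  the partial sums are Cauchy.\<close>

lemma summable_AE:
  assumes summable: "summable (\<lambda>k. \<integral>\<omega>. (D k \<omega>)\<^sup>2 \<partial>M)"
  shows "AE \<omega> in M. summable (\<lambda>k. D k \<omega>)"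
proof -
  define E where "E m \<epsilon> = {\<omega>\<in>space M. \<exists>j. \<epsilon> \<le> \<bar>\<Sum>k<j. D (k + m) \<omega>\<bar>}" for m and \<epsilon> :: real
  have [measurable]: "E m \<epsilon> \<in> sets M" for m \<epsilon> unfolding E_def by measurable
  have E_le: "prob (E m \<epsilon>) \<le> (\<Sum>k. \<integral>\<omega>. (D (k + m) \<omega>)\<^sup>2 \<partial>M) / \<epsilon>\<^sup>2" if "0 < \<epsilon>" for m \<epsilon>
  proof -
    interpret shift: martingale_differences M "\<lambda>n. F (n + m)" "\<lambda>n. D (n + m)" by (rule shifted)
    \<comment> \<open>The maximal inequality covers finitely many times; continuity from below along
      \<open>G\<close> extends it to all of them.\<close>
    define G where "G n = {\<omega>\<in>space M. \<exists>j\<le>n. \<epsilon> \<le> \<bar>\<Sum>k<j. D (k + m) \<omega>\<bar>}" for n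
    have "(\<lambda>n. prob (G n)) \<longlonglongrightarrow> prob (\<Union>n. G n)"
    proof (rule finite_Lim_measure_incseq)
      have "G n \<in> sets M" for n unfolding G_def by measurable
      then show "range G \<subseteq> sets M" by auto
      show "incseq G" by (auto simp: G_def incseq_def intro: le_trans)
    qed
    also have "(\<Union>n. G n) = E m \<epsilon>" by (auto simp: G_def E_def)
    finally show ?thesis
    proof (rule LIMSEQ_le_const2, intro exI allI impI)
      fix n
      have "prob (G n) \<le> (\<Sum>k<n. \<integral>\<omega>. (D (k + m) \<omega>)\<^sup>2 \<partial>M) / \<epsilon>\<^sup>2"
        unfolding G_def by (rule shift.maximal_inequality[OF that])
      also have "\<dots> \<le> (\<Sum>k. \<integral>\<omega>. (D (k + m) \<omega>)\<^sup>2 \<partial>M) / \<epsilon>\<^sup>2"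
        using summable_ignore_initial_segment[OF summable, of m]
        by (intro divide_right_mono sum_le_suminf) auto
      finally show "prob (G n) \<le> (\<Sum>k. \<integral>\<omega>. (D (k + m) \<omega>)\<^sup>2 \<partial>M) / \<epsilon>\<^sup>2" .
    qed
  qed
  have "AE \<omega> in M. \<exists>m. \<omega> \<notin> E m \<epsilon>" if "0 < \<epsilon>" for \<epsilon>
  proof -
    have "(\<lambda>m. (\<Sum>k. \<integral>\<omega>. (D (k + m) \<omega>)\<^sup>2 \<partial>M) / \<epsilon>\<^sup>2) \<longlonglongrightarrow> 0 / \<epsilon>\<^sup>2"
      using that by (intro tendsto_divide suminf_exist_split2[OF summable] tendsto_const) auto
    moreover have "prob (\<Inter>m. E m \<epsilon>) \<le> (\<Sum>k. \<integral>\<omega>. (D (k + m) \<omega>)\<^sup>2 \<partial>M) / \<epsilon>\<^sup>2" for m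
      using E_le[OF that, of m] finite_measure_mono[of "\<Inter>m. E m \<epsilon>" "E m \<epsilon>"]
      by (meson INT_lower UNIV_I \<open>\<And>m \<epsilon>. E m \<epsilon> \<in> sets M\<close> order_trans)
    ultimately have "prob (\<Inter>m. E m \<epsilon>) \<le> 0"
      by (intro LIMSEQ_le_const[of _ 0]) auto
    then have "(\<Inter>m. E m \<epsilon>) \<in> null_sets M"
      by (simp add: measure_le_0_iff emeasure_eq_measure null_sets_def)
    from AE_not_in[OF this] show ?thesis by eventually_elim auto
  qed
  then have "AE \<omega> in M. \<forall>i. \<exists>m. \<omega> \<notin> E m (1 / real (Suc i))"
    by (subst AE_all_countable) auto
  with AE_space show ?thesis
  proof eventually_elim
    fix \<omega> assume \<omega>: "\<omega> \<in> space M" "\<forall>i. \<exists>m. \<omega> \<notin> E m (1 / real (Suc i))"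
    have "Cauchy (\<lambda>n. \<Sum>k<n. D k \<omega>)"
    proof (rule CauchyI')
      fix e :: real assume "0 < e"
      then obtain i where i: "1 / real (Suc i) < e / 2"
        using nat_approx_posE[of "e/2"] by auto
      obtain m where "\<omega> \<notin> E m (1 / real (Suc i))" using \<omega> by blast
      then have m: "\<bar>\<Sum>k<j. D (k + m) \<omega>\<bar> < e / 2" for j
        using \<omega>(1) i by (auto simp: E_def not_le dest: spec[of _ j] less_trans)
      have split: "(\<Sum>k<m + j. D k \<omega>) = (\<Sum>k<m. D k \<omega>) + (\<Sum>k<j. D (k + m) \<omega>)" for j
        by (induction j) (auto simp: add.commute)
      have "\<bar>(\<Sum>k<p. D k \<omega>) - (\<Sum>k<q. D k \<omega>)\<bar> < e" if "p \<ge> m" "q \<ge> m" for p q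
        using split[of "p - m"] split[of "q - m"] m[of "p - m"] m[of "q - m"] that unfolding abs_less_iff by auto
      then show "\<exists>N. \<forall>p\<ge>N. \<forall>q>p. dist (\<Sum>k<p. D k \<omega>) (\<Sum>k<q. D k \<omega>) < e"
        by (intro exI[of _ m]) (auto simp: dist_real_def)
    qed
    then show "summable (\<lambda>k. D k \<omega>)"
      by (simp add: summable_iff_convergent Cauchy_convergent_iff)
  qed
qed

text \<open>A weight known at time n comes out of the conditional expectation, so the products are
  martingale differences again. The deterministic bound on the weights makes their variances of
  order 1/n^2.\<close>

lemma summable_weighted_AE:
  assumes w: "\<And>n. w n \<in> borel_measurable (F n)"
    and w_le: "\<And>n \<omega>. \<omega> \<in> space M \<Longrightarrow> \<bar>w n \<omega>\<bar> \<le> K / real (Suc n)"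
    and B: "\<And>n. (\<integral>\<omega>. (D n \<omega>)\<^sup>2 \<partial>M) \<le> B"
  shows "AE \<omega> in M. summable (\<lambda>n. w n \<omega> * D n \<omega>)"
proof -
  have [measurable]: "w n \<in> borel_measurable M" for n
    by (rule measurable_from_subalg[OF sub w])
  have sq: "(w n \<omega> * D n \<omega>)\<^sup>2 \<le> K\<^sup>2 / (real (Suc n))\<^sup>2 * (D n \<omega>)\<^sup>2" if "\<omega> \<in> space M" for n \<omega>
    using power_mono[OF w_le[OF that, of n], of 2]
    unfolding power_mult_distrib by (intro mult_right_mono) (auto simp: power_divide)
  have int: "integrable M (\<lambda>\<omega>. (w n \<omega> * D n \<omega>)\<^sup>2)" for n
  proof (rule Bochner_Integration.integrable_bound)
    show "integrable M (\<lambda>\<omega>. K\<^sup>2 / (real (Suc n))\<^sup>2 * (D n \<omega>)\<^sup>2)"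
      by (intro integrable_mult_right square_integrable)
  qed (use sq in auto)
  have D_int: "integrable M (D n)" for n
    using square_integrable by (rule square_integrable_imp_integrable[rotated]) simp
  have wD: "integrable M (\<lambda>\<omega>. w n \<omega> * D n \<omega>)" for n
    using int by (rule square_integrable_imp_integrable[rotated]) simp
  interpret weighted: martingale_differences M F "\<lambda>n \<omega>. w n \<omega> * D n \<omega>"
  proof unfold_locales
    fix n
    interpret sigma_finite_subalgebra M "F n" by (rule sigma_finite_F)
    show "AE \<omega> in M. real_cond_exp M (F n) (\<lambda>\<omega>. w n \<omega> * D n \<omega>) \<omega> = 0"
      using real_cond_exp_mult[OF w measurable_D wD] centered[of n] by eventually_elim simp
    show "(\<lambda>\<omega>. w n \<omega> * D n \<omega>) \<in> borel_measurable (F (Suc n))"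
      using adapted measurable_from_subalg[OF filtration[of n "Suc n"] w] by auto
  qed (use sub filtration int in auto)
  show ?thesis
  proof (rule weighted.summable_AE, rule summable_comparison_test')
    show "summable (\<lambda>n. K\<^sup>2 * B * (1 / (real (Suc n))\<^sup>2))"
      by (intro summable_mult summable_inverse_square_Suc)
    fix n
    have "(\<integral>\<omega>. (w n \<omega> * D n \<omega>)\<^sup>2 \<partial>M) \<le> (\<integral>\<omega>. K\<^sup>2 / (real (Suc n))\<^sup>2 * (D n \<omega>)\<^sup>2 \<partial>M)"
      using sq by (intro integral_mono int integrable_mult_right square_integrable) auto
    also have "\<dots> \<le> K\<^sup>2 / (real (Suc n))\<^sup>2 * B"
      unfolding integral_mult_right_zero by (rule mult_left_mono[OF B]) simp
    finally show "norm (\<integral>\<omega>. (w n \<omega> * D n \<omega>)\<^sup>2 \<partial>M) \<le> K\<^sup>2 * B * (1 / (real (Suc n))\<^sup>2)"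
      by (simp add: field_simps)
  qed
qed

end

subsection \<open>Conditional laws\<close>

context
  fixes M F :: "'w measure" and N :: "'b measure" and X :: "'w \<Rightarrow> 'b" and K :: "'w \<Rightarrow> 'b measure"
  assumes prob: "prob_space M" and sub: "subalgebra M F" and law: "has_cond_law M F N X K"
    and X [measurable]: "X \<in> measurable M N" and K: "K \<in> measurable F (subprob_algebra N)"
begin

interpretation prob_space M by (rule prob)

interpretation sigma_finite_subalgebra M F
  by (rule sigma_finite_subalgebra[OF sub])

private lemma K_M [measurable]: "K \<in> measurable M (subprob_algebra N)"
  by (rule measurable_from_subalg[OF sub K])

text \<open>A conditional law is given set by set, each with its own null set, so it cannot be
  integrated path by path. Instead M is restricted to the event \<open>A\<close>; the law of
  \<open>X\<close> under this restriction and the mixture of the kernels then agree on sets, hence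
  as measures, hence on all nonnegative functions.\<close>

lemma cond_law_nn_integral_on:
  assumes \<phi> [measurable]: "\<phi> \<in> borel_measurable N" and A: "A \<in> sets F"
  shows "(\<integral>\<^sup>+\<omega>. indicator A \<omega> * \<phi> (X \<omega>) \<partial>M) = (\<integral>\<^sup>+\<omega>. indicator A \<omega> * (\<integral>\<^sup>+x. \<phi> x \<partial>K \<omega>) \<partial>M)"
proof -
  have AM [measurable]: "A \<in> sets M" using A sub by (auto simp: subalgebra_def)
  define MA where "MA = density M (indicator A)"
  have [simp, measurable_cong]: "sets MA = sets M" by (simp add: MA_def)
  have [simp]: "space MA = space M" by (simp add: MA_def)
  have KA: "K \<in> measurable MA (subprob_algebra N)" by measurable
  have "distr MA N X = MA \<bind> K"
  proof (rule measure_eqI)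
    show sets_eq: "sets (distr MA N X) = sets (MA \<bind> K)"
      using sets_bind_measurable[OF KA] not_empty by simp
    fix B assume "B \<in> sets (distr MA N X)"
    then have B [measurable]: "B \<in> sets N" by simp
    have int: "integrable M (\<lambda>\<omega>. indicator A \<omega> * indicat_real B (X \<omega>))"
      by (rule integrable_const_bound[where B=1]) (auto simp: indicator_def)
    have KB: "measure (K \<omega>) B \<le> 1" "emeasure (K \<omega>) B = ennreal (measure (K \<omega>) B)"
      if "\<omega> \<in> space M" for \<omega>
      using subprob_space_kernel[OF K_M that]
      by (auto simp: subprob_space.subprob_measure_le_1 subprob_space.axioms(1)
          finite_measure.emeasure_eq_measure)
    have intK: "integrable M (\<lambda>\<omega>. indicat_real A \<omega> * measure (K \<omega>) B)"
      by (rule integrable_const_bound[where B=1]) (use KB in \<open>auto simp: indicator_def\<close>)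
    have "emeasure (distr MA N X) B = (\<integral>\<^sup>+\<omega>. indicator B (X \<omega>) \<partial>MA)"
      by (subst nn_integral_distr[symmetric, where M=MA and f="indicator B" and M'=N]) auto
    also have "\<dots> = (\<integral>\<^sup>+\<omega>. indicator A \<omega> * indicator B (X \<omega>) \<partial>M)"
      by (simp add: MA_def nn_integral_density)
    also have "\<dots> = (\<integral>\<^sup>+\<omega>. ennreal (indicator A \<omega> * indicator B (X \<omega>)) \<partial>M)"
      by (intro nn_integral_cong) (auto simp: indicator_def)
    also have "\<dots> = ennreal (\<integral>\<omega>. indicator A \<omega> * indicator B (X \<omega>) \<partial>M)"
      using int by (intro nn_integral_eq_integral) auto
    also have "(\<integral>\<omega>. indicator A \<omega> * indicator B (X \<omega>) \<partial>M) =
        (\<integral>\<omega>. indicator A \<omega> * real_cond_exp M F (\<lambda>\<omega>. indicator B (X \<omega>)) \<omega> \<partial>M)"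
      using A by (intro real_cond_exp_intg(2)[OF int, symmetric]) auto
    also have "\<dots> = (\<integral>\<omega>. indicator A \<omega> * measure (K \<omega>) B \<partial>M)"
      using law B unfolding has_cond_law_def by (intro integral_cong_AE) auto
    also have "ennreal \<dots> = (\<integral>\<^sup>+\<omega>. ennreal (indicator A \<omega> * measure (K \<omega>) B) \<partial>M)"
      using intK by (intro nn_integral_eq_integral[symmetric]) auto
    also have "\<dots> = (\<integral>\<^sup>+\<omega>. indicator A \<omega> * emeasure (K \<omega>) B \<partial>M)"
      using KB by (intro nn_integral_cong) (auto simp: indicator_def)
    also have "\<dots> = emeasure (MA \<bind> K) B"
      using not_empty by (subst emeasure_bind[OF _ KA]) (auto simp: MA_def nn_integral_density)
    finally show "emeasure (distr MA N X) B = emeasure (MA \<bind> K) B" .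
  qed
  then have "(\<integral>\<^sup>+x. \<phi> x \<partial>distr MA N X) = (\<integral>\<^sup>+x. \<phi> x \<partial>(MA \<bind> K))" by simp
  then show ?thesis
    by (simp add: nn_integral_distr nn_integral_bind[OF \<phi> KA]) (simp add: MA_def nn_integral_density)
qed

lemma cond_law_nn_integral:
  assumes "\<phi> \<in> borel_measurable N"
  shows "(\<integral>\<^sup>+\<omega>. \<phi> (X \<omega>) \<partial>M) = (\<integral>\<^sup>+\<omega>. (\<integral>\<^sup>+x. \<phi> x \<partial>K \<omega>) \<partial>M)"
proof -
  have "space M \<in> sets F" using sub sets.top[of F] by (simp add: subalgebra_def)
  from cond_law_nn_integral_on[OF assms this] show ?thesis
    by (simp cong: nn_integral_cong_simp)
qed

lemma cond_law_nn_cond_exp: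
  assumes [measurable]: "\<phi> \<in> borel_measurable N"
  shows "AE \<omega> in M. (\<integral>\<^sup>+x. \<phi> x \<partial>K \<omega>) = nn_cond_exp M F (\<lambda>\<omega>. \<phi> (X \<omega>)) \<omega>"
proof (rule nn_cond_exp_charact)
  show "(\<lambda>\<omega>. \<integral>\<^sup>+x. \<phi> x \<partial>K \<omega>) \<in> borel_measurable F" using K by measurable
qed (use cond_law_nn_integral_on[OF assms] in \<open>auto simp: mult.commute\<close>)

text \<open>The positive and negative parts are handled separately, as in the definition of the real
  conditional expectation. Recombining them requires \<phi> to be integrable under
  \<open>K \<omega>\<close> for almost every \<omega>, which holds because the expectation of the
  inner integral of |\<phi>| is that of |\<phi> (X)|, hence finite.\<close>

lemma cond_law_real_cond_exp:
  fixes \<phi> :: "'b \<Rightarrow> real"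
  assumes \<phi> [measurable]: "\<phi> \<in> borel_measurable N" and int: "integrable M (\<lambda>\<omega>. \<phi> (X \<omega>))"
  shows "AE \<omega> in M. real_cond_exp M F (\<lambda>\<omega>. \<phi> (X \<omega>)) \<omega> = (\<integral>x. \<phi> x \<partial>K \<omega>)"
proof -
  have "(\<integral>\<^sup>+\<omega>. (\<integral>\<^sup>+x. ennreal (norm (\<phi> x)) \<partial>K \<omega>) \<partial>M) < \<infinity>"
    using int by (subst cond_law_nn_integral[symmetric]) (auto simp: integrable_iff_bounded)
  then have "AE \<omega> in M. (\<integral>\<^sup>+x. ennreal (norm (\<phi> x)) \<partial>K \<omega>) \<noteq> \<infinity>"
    by (intro nn_integral_PInf_AE) auto
  moreover have "AE \<omega> in M. (\<integral>\<^sup>+x. ennreal (\<phi> x) \<partial>K \<omega>) = nn_cond_exp M F (\<lambda>\<omega>. ennreal (\<phi> (X \<omega>))) \<omega>"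
    by (rule cond_law_nn_cond_exp) simp
  moreover have "AE \<omega> in M. (\<integral>\<^sup>+x. ennreal (- \<phi> x) \<partial>K \<omega>) = nn_cond_exp M F (\<lambda>\<omega>. ennreal (- \<phi> (X \<omega>))) \<omega>"
    by (rule cond_law_nn_cond_exp) simp
  ultimately show ?thesis using AE_space
  proof eventually_elim
    case (elim \<omega>)
    have "sets (K \<omega>) = sets N" by (rule sets_kernel[OF K_M elim(4)])
    then have "\<phi> \<in> borel_measurable (K \<omega>)" by (simp cong: measurable_cong_sets)
    with elim(1) have "integrable (K \<omega>) \<phi>" by (simp add: integrable_iff_bounded less_top)
    from real_lebesgue_integral_def[OF this] elim(2,3) show ?case
      by (simp add: real_cond_exp_def)
  qed
qed

end

subsection \<open>Counting measures\<close>

lemma space_counting_space: "space (counting_space S) = counting_measures S"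
proof -
  have "sets S \<noteq> {}" using sets.empty_sets by blast
  then show ?thesis by (simp add: counting_space_def space_Sup_eq_UN)
qed

lemma measurable_emeasure_counting_space:
  "A \<in> sets S \<Longrightarrow> (\<lambda>\<nu>. emeasure \<nu> A) \<in> borel_measurable (counting_space S)"
  unfolding counting_space_def
  by (rule measurable_SUP1) (auto intro!: measurable_vimage_algebra1)

lemma sets_counting_measures: "\<nu> \<in> counting_measures S \<Longrightarrow> sets \<nu> = sets S"
  by (simp add: counting_measures_def)

lemma space_counting_measures: "\<nu> \<in> counting_measures S \<Longrightarrow> space \<nu> = space S"
  by (intro sets_eq_imp_space_eq sets_counting_measures)

lemma finite_counting_measures:
  assumes "\<nu> \<in> counting_measures S"
  shows "finite_measure \<nu>"
proof
  obtain X where X: "emeasure \<nu> (space S) = (\<Sum>x\<in>#X. emeasure (return S x) (space S))"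
    using assms by (auto simp: counting_measures_def)
  have "(\<Sum>x\<in>#X. emeasure (return S x) (space S)) \<noteq> \<top>"
    by (induction X) (auto simp: emeasure_return indicator_def)
  then show "emeasure \<nu> (space \<nu>) \<noteq> \<infinity>"
    using X by (simp add: space_counting_measures[OF assms])
qed

lemma integral_normalized:
  fixes f :: "'a \<Rightarrow> real"
  assumes "finite_measure \<nu>" and f [measurable]: "f \<in> borel_measurable \<nu>"
  shows "(\<integral>x. f x \<partial>normalized \<nu>) = (\<integral>x. f x \<partial>\<nu>) / total_mass \<nu>"
proof (cases "total_mass \<nu> = 0")
  \<comment> \<open>For mass 0 the scaling factor is \<open>inverse 0\<close>, that is \<infinity>,
    but scaling the zero measure leaves it zero. Both sides are 0, the right one because of division
    by 0.\<close>
  case True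
  interpret finite_measure \<nu> by fact
  have "AE x in \<nu>. False"
    using True by (intro AE_I[of _ _ "space \<nu>"]) (auto simp: emeasure_eq_measure)
  moreover have "AE x in normalized \<nu>. False"
    using True by (intro AE_I[of _ _ "space \<nu>"])
      (auto simp: normalized_def emeasure_eq_measure space_scale_measure)
  ultimately show ?thesis using True
    by (simp add: integral_eq_zero_AE AE_mp[OF _ AE_I2])
next
  case False
  interpret finite_measure \<nu> by fact
  have pos: "0 < total_mass \<nu>" using False by (simp add: zero_less_measure_iff)
  have "normalized \<nu> = density \<nu> (\<lambda>_. ennreal (1 / total_mass \<nu>))"
    using pos by (intro measure_eqI)
      (auto simp: normalized_def emeasure_density emeasure_eq_measure inverse_ennreal
        nn_integral_cmult_indicator inverse_eq_divide)
  then show ?thesis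
    using pos by (simp add: integral_density)
qed

text \<open>This makes the normalized urn a measurable kernel for the color. Its total mass is 1, or
  0 for the empty urn, so it lives among subprobabilities.\<close>

lemma measurable_normalized:
  assumes "space S \<noteq> {}"
  shows "normalized \<in> measurable (counting_space S) (subprob_algebra S)"
proof (rule measurable_subprob_algebra)
  fix \<nu> assume "\<nu> \<in> space (counting_space S)"
  then have \<nu>: "\<nu> \<in> counting_measures S" by (simp add: space_counting_space)
  interpret finite_measure \<nu> by (rule finite_counting_measures[OF \<nu>])
  show "sets (normalized \<nu>) = sets S"
    using sets_counting_measures[OF \<nu>] by (simp add: normalized_def)
  show "subprob_space (normalized \<nu>)"
  proof
    show "emeasure (normalized \<nu>) (space (normalized \<nu>)) \<le> 1"
    proof (cases "emeasure \<nu> (space \<nu>) = 0")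
      case False
      then show ?thesis
        using ennreal_divide_self[of "emeasure \<nu> (space \<nu>)"]
        by (simp add: normalized_def space_scale_measure divide_ennreal_def mult.commute
            emeasure_eq_measure)
    qed (simp add: normalized_def space_scale_measure)
    show "space (normalized \<nu>) \<noteq> {}"
      using assms space_counting_measures[OF \<nu>] by (simp add: normalized_def space_scale_measure)
  qed
next
  fix A assume A: "A \<in> sets S"
  have "(\<lambda>\<nu>. inverse (emeasure \<nu> (space S)) * emeasure \<nu> A) \<in> borel_measurable (counting_space S)"
    using A by (intro borel_measurable_times_ennreal borel_measurable_inverse_ennreal
        measurable_emeasure_counting_space) auto
  then show "(\<lambda>\<nu>. emeasure (normalized \<nu>) A) \<in> borel_measurable (counting_space S)"
    by (rule measurable_cong[THEN iffD1, rotated])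
       (simp add: normalized_def space_counting_space space_counting_measures)
qed

lemma measurable_total_mass_counting_space:
  "total_mass \<in> borel_measurable (counting_space S)"
proof -
  have "(\<lambda>\<nu>. enn2real (emeasure \<nu> (space S))) \<in> borel_measurable (counting_space S)"
    by (intro borel_measurable_enn2real measurable_emeasure_counting_space) auto
  then show ?thesis
    by (rule measurable_cong[THEN iffD1, rotated])
       (simp add: measure_def space_counting_space space_counting_measures)
qed

text \<open>The sigma-field is generated by evaluations on sets, while measurability of integrals is
  known for subprobability measures. Factoring \<nu>(f) into total mass and normalized integral
  connects the two.\<close>

lemma measurable_integral_counting_space:
  fixes f :: "'a \<Rightarrow> real"
  assumes "space S \<noteq> {}" and f: "f \<in> borel_measurable S"
  shows "(\<lambda>\<nu>. \<integral>x. f x \<partial>\<nu>) \<in> borel_measurable (counting_space S)"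
proof -
  have "(\<lambda>\<nu>. total_mass \<nu> * (\<integral>x. f x \<partial>normalized \<nu>)) \<in> borel_measurable (counting_space S)"
    using measurable_compose[OF measurable_normalized[OF assms(1)] integral_measurable_subprob_algebra[OF f]]
    by (intro borel_measurable_times measurable_total_mass_counting_space)
  then show ?thesis
  proof (rule measurable_cong[THEN iffD1, rotated])
    fix \<nu> assume "\<nu> \<in> space (counting_space S)"
    then have \<nu>: "\<nu> \<in> counting_measures S" by (simp add: space_counting_space)
    interpret finite_measure \<nu> by (rule finite_counting_measures[OF \<nu>])
    have f\<nu>: "f \<in> borel_measurable \<nu>"
      using f sets_counting_measures[OF \<nu>] by (simp cong: measurable_cong_sets)
    show "total_mass \<nu> * (\<integral>x. f x \<partial>normalized \<nu>) = (\<integral>x. f x \<partial>\<nu>)"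
    proof (cases "total_mass \<nu> = 0")
      case True
      have "AE x in \<nu>. f x = 0"
        using True by (intro AE_I[of _ _ "space \<nu>"]) (auto simp: emeasure_eq_measure)
      with True show ?thesis by (simp add: integral_eq_zero_AE)
    qed (simp add: integral_normalized[OF finite_measure_axioms f\<nu>])
  qed
qed

lemma abs_integral_le_total_mass:
  fixes f :: "'a \<Rightarrow> real"
  assumes "finite_measure \<nu>" "\<And>x. x \<in> space \<nu> \<Longrightarrow> \<bar>f x\<bar> \<le> K"
  shows "\<bar>\<integral>x. f x \<partial>\<nu>\<bar> \<le> K * total_mass \<nu>"
proof (cases "integrable \<nu> f")
  case True
  interpret finite_measure \<nu> by fact
  have "\<bar>\<integral>x. f x \<partial>\<nu>\<bar> \<le> (\<integral>x. K \<partial>\<nu>)"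
    using assms by (intro order_trans[OF integral_abs_bound] integral_mono True integrable_abs) auto
  then show ?thesis by (simp add: mult.commute)
next
  \<comment> \<open>Here the integral is 0 by convention, so the bound only has to be nonnegative.
    On an empty space \<open>K\<close> may be negative, but then the mass is 0.\<close>
  case False
  have "0 \<le> K" if "space \<nu> \<noteq> {}"
    using assms(2) that by (meson abs_ge_zero all_not_in_conv order_trans)
  then have "0 \<le> K * total_mass \<nu>" by (cases "space \<nu> = {}") auto
  with False show ?thesis by (simp add: not_integrable_integral_eq)
qed

lemma integrable_bounded_measurable:
  assumes "finite_measure \<nu>" "sets \<nu> = sets S" "f \<in> bounded_measurable S"
  shows "integrable \<nu> f"
proof -
  interpret finite_measure \<nu> by fact
  obtain K where "\<And>x. x \<in> space S \<Longrightarrow> norm (f x) \<le> K"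
    using assms(3) by (auto simp: bounded_measurable_def bounded_iff)
  then show ?thesis
    using assms sets_eq_imp_space_eq[OF assms(2)]
    by (intro integrable_const_bound[where B=K])
       (auto simp: bounded_measurable_def cong: measurable_cong_sets)
qed

text \<open>The urn recursion is an identity between values on sets, and the coefficient C may be
  negative, so neither side need be a sum of measures. A vanishing signed combination expresses it
  without subtracting measures, and linearity and limits carry it from indicators to bounded
  functions.\<close>

lemma linear_combination_integral_zero:
  fixes c :: "'i \<Rightarrow> real" and \<nu> :: "'i \<Rightarrow> 'a measure"
  assumes "finite I" and fin: "\<And>i. i \<in> I \<Longrightarrow> finite_measure (\<nu> i)"
    and sets: "\<And>i. i \<in> I \<Longrightarrow> sets (\<nu> i) = sets S"
    and zero: "\<And>A. A \<in> sets S \<Longrightarrow> (\<Sum>i\<in>I. c i * measure (\<nu> i) A) = 0"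
    and f: "f \<in> bounded_measurable S"
  shows "(\<Sum>i\<in>I. c i * (\<integral>x. f x \<partial>\<nu> i)) = 0"
proof -
  have space: "space (\<nu> i) = space S" if "i \<in> I" for i
    using sets_eq_imp_space_eq[OF sets[OF that]] .
  have meas: "g \<in> borel_measurable (\<nu> i)" if "g \<in> borel_measurable S" "i \<in> I" for g :: "'a \<Rightarrow> real" and i
    using that sets by (simp cong: measurable_cong_sets)
  have bounded: "integrable (\<nu> i) g" if "g \<in> borel_measurable S" "\<And>x. x \<in> space S \<Longrightarrow> \<bar>g x\<bar> \<le> K" "i \<in> I"
    for g :: "'a \<Rightarrow> real" and i K
    using that fin sets
    by (intro integrable_bounded_measurable[of _ S]) (auto simp: bounded_measurable_def bounded_iff)
  \<comment> \<open>Boundedness is a premise inside the induction: it gives integrability of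
    summands and domination of increasing limits. For nonnegative functions an upper bound passes
    down to summands and approximants.\<close>
  have nonneg: "(\<exists>K. \<forall>x\<in>space S. g x \<le> K) \<longrightarrow> (\<Sum>i\<in>I. c i * (\<integral>x. g x \<partial>\<nu> i)) = 0"
    if "g \<in> borel_measurable S" "\<And>x. 0 \<le> g x" for g
    using that
  proof (induction g rule: borel_measurable_induct_real)
    case (set A)
    then have "(\<Sum>i\<in>I. c i * (\<integral>x. indicator A x \<partial>\<nu> i)) = (\<Sum>i\<in>I. c i * measure (\<nu> i) A)"
      using sets space by (intro sum.cong refl) (simp add: Int_absorb2 sets.sets_into_space)
    with zero[OF set] show ?case by simp
  next
    case (mult u r)
    show ?case
    proof (cases "r = 0")
      case False
      have "(\<exists>K. \<forall>x\<in>space S. u x \<le> K)" if "\<forall>x\<in>space S. r * u x \<le> K" for K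
        using that False mult(1) by (intro exI[of _ "K / r"]) (auto simp: field_simps)
      then show ?thesis
        using mult by (auto simp: mult.left_commute[of _ r] sum_distrib_left[symmetric])
    qed simp
  next
    case (add u v)
    show ?case
    proof
      assume "\<exists>K. \<forall>x\<in>space S. v x + u x \<le> K"
      then obtain K where K: "\<And>x. x \<in> space S \<Longrightarrow> v x + u x \<le> K" by blast
      have le: "u x \<le> K" "v x \<le> K" if "x \<in> space S" for x
        using K[OF that] add(2)[of x] add(4)[of x] by auto
      have zeros: "(\<Sum>i\<in>I. c i * (\<integral>x. u x \<partial>\<nu> i)) = 0" "(\<Sum>i\<in>I. c i * (\<integral>x. v x \<partial>\<nu> i)) = 0"
        using add.IH le by blast+
      have "(\<Sum>i\<in>I. c i * (\<integral>x. v x + u x \<partial>\<nu> i)) =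
          (\<Sum>i\<in>I. c i * (\<integral>x. v x \<partial>\<nu> i) + c i * (\<integral>x. u x \<partial>\<nu> i))"
      proof (rule sum.cong[OF refl])
        fix i assume "i \<in> I"
        then have "integrable (\<nu> i) u" "integrable (\<nu> i) v"
          using bounded[OF add(1), of K i] bounded[OF add(3), of K i] le add(2,4) by simp_all
        then show "c i * (\<integral>x. v x + u x \<partial>\<nu> i) = c i * (\<integral>x. v x \<partial>\<nu> i) + c i * (\<integral>x. u x \<partial>\<nu> i)"
          by (simp add: distrib_left)
      qed
      then show "(\<Sum>i\<in>I. c i * (\<integral>x. v x + u x \<partial>\<nu> i)) = 0"
        using zeros by (simp add: sum.distrib)
    qed
  next
    case (seq U)
    show ?case
    proof
      assume "\<exists>K. \<forall>x\<in>space S. g x \<le> K"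
      then obtain K where K: "\<And>x. x \<in> space S \<Longrightarrow> g x \<le> K" by blast
      have UK: "U n x \<le> K" if "x \<in> space S" for n x
      proof -
        have "U n x \<le> g x"
          using seq(3) seq(4)[OF that] by (intro incseq_le) (auto simp: incseq_def le_fun_def)
        with K[OF that] show ?thesis by simp
      qed
      then have "(\<Sum>i\<in>I. c i * (\<integral>x. U n x \<partial>\<nu> i)) = 0" for n using seq.IH by blast
      moreover have "(\<lambda>n. \<Sum>i\<in>I. c i * (\<integral>x. U n x \<partial>\<nu> i)) \<longlonglongrightarrow> (\<Sum>i\<in>I. c i * (\<integral>x. g x \<partial>\<nu> i))"
      proof (intro tendsto_sum tendsto_mult_left integral_dominated_convergence[where w="\<lambda>_. K"])
        fix i assume i: "i \<in> I"
        interpret finite_measure "\<nu> i" by (rule fin[OF i])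
        show "integrable (\<nu> i) (\<lambda>_. K)" by simp
        show "g \<in> borel_measurable (\<nu> i)" "\<And>n. U n \<in> borel_measurable (\<nu> i)"
          using that(1) seq(1) i by (auto intro: meas)
      qed (use seq UK space in auto)
      ultimately show "(\<Sum>i\<in>I. c i * (\<integral>x. g x \<partial>\<nu> i)) = 0"
        by (simp add: LIMSEQ_const_iff)
    qed
  qed
  obtain K where K: "\<And>x. x \<in> space S \<Longrightarrow> \<bar>f x\<bar> \<le> K"
    using f by (auto simp: bounded_measurable_def bounded_iff)
  have f_meas: "f \<in> borel_measurable S" using f by (simp add: bounded_measurable_def)
  have "(\<integral>x. f x \<partial>\<nu> i) = (\<integral>x. max 0 (f x) \<partial>\<nu> i) - (\<integral>x. max 0 (- f x) \<partial>\<nu> i)" if "i \<in> I" for i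
  proof -
    have "(\<integral>x. f x \<partial>\<nu> i) = (\<integral>x. max 0 (f x) - max 0 (- f x) \<partial>\<nu> i)"
      by (intro Bochner_Integration.integral_cong) auto
    also have "\<dots> = (\<integral>x. max 0 (f x) \<partial>\<nu> i) - (\<integral>x. max 0 (- f x) \<partial>\<nu> i)"
      using f_meas abs_le_D1[OF K] abs_le_D2[OF K] order_trans[OF abs_ge_zero K] that
      by (intro Bochner_Integration.integral_diff bounded[where K=K]) auto
    finally show ?thesis .
  qed
  then have "(\<Sum>i\<in>I. c i * (\<integral>x. f x \<partial>\<nu> i)) =
      (\<Sum>i\<in>I. c i * (\<integral>x. max 0 (f x) \<partial>\<nu> i)) - (\<Sum>i\<in>I. c i * (\<integral>x. max 0 (- f x) \<partial>\<nu> i))"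
    by (simp add: right_diff_distrib sum_subtractf)
  moreover have "(\<Sum>i\<in>I. c i * (\<integral>x. max 0 (f x) \<partial>\<nu> i)) = 0"
    using f_meas abs_le_D1[OF K] order_trans[OF abs_ge_zero K]
    by (intro nonneg[rule_format] exI[of _ K]) auto
  moreover have "(\<Sum>i\<in>I. c i * (\<integral>x. max 0 (- f x) \<partial>\<nu> i)) = 0"
    using f_meas abs_le_D2[OF K] order_trans[OF abs_ge_zero K]
    by (intro nonneg[rule_format] exI[of _ K]) auto
  ultimately show ?thesis by simp
qed

subsection \<open>Urn histories\<close>

context urn_scheme
begin

abbreviation history :: "nat \<Rightarrow> nat \<Rightarrow> 'w measure" where
  "history \<equiv> urn_history S M U \<sigma> C \<xi>"

lemma space_history [simp]: "space (history n m) = space M"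
  unfolding urn_history_def by (rule space_measure_of) auto

definition history_generator :: "nat \<Rightarrow> nat \<Rightarrow> 'w set set" where
  "history_generator n m = {U k -` A \<inter> space M | k A. k \<le> n \<and> A \<in> sets (counting_space S)}
       \<union> {(\<lambda>\<omega>. (C k \<omega>, \<xi> k \<omega>)) -` A \<inter> space M | k A.
            1 \<le> k \<and> k \<le> n \<and> A \<in> sets (replacement_space S)}
       \<union> {\<sigma> k -` A \<inter> space M | k A. k < m \<and> A \<in> sets S}"

lemma sets_history: "sets (history n m) = sigma_sets (space M) (history_generator n m)"
  unfolding urn_history_def history_generator_def by (rule sets_measure_of) auto

lemma history_generatorI:
  "k \<le> n \<Longrightarrow> A \<in> sets (counting_space S) \<Longrightarrow> U k -` A \<inter> space M \<in> history_generator n m"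
  "k < n \<Longrightarrow> B \<in> sets (replacement_space S) \<Longrightarrow>
    (\<lambda>\<omega>. (C (Suc k) \<omega>, \<xi> (Suc k) \<omega>)) -` B \<inter> space M \<in> history_generator n m"
  "k < m \<Longrightarrow> E \<in> sets S \<Longrightarrow> \<sigma> k -` E \<inter> space M \<in> history_generator n m"
  unfolding history_generator_def
  by (rule UnI1, rule UnI1, blast)
     (rule UnI1, rule UnI2, intro CollectI exI[of _ "Suc k"] exI[of _ B], simp, rule UnI2, blast)

lemma history_generatorE:
  assumes "E \<in> history_generator n m"
  obtains k A where "E = U k -` A \<inter> space M" "k \<le> n" "A \<in> sets (counting_space S)"
  | k A where "E = (\<lambda>\<omega>. (C (Suc k) \<omega>, \<xi> (Suc k) \<omega>)) -` A \<inter> space M" "k < n"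
      "A \<in> sets (replacement_space S)"
  | k A where "E = \<sigma> k -` A \<inter> space M" "k < m" "A \<in> sets S"
  using assms unfolding history_generator_def
proof (elim UnE CollectE exE conjE)
  fix k A
  assume "E = (\<lambda>\<omega>. (C k \<omega>, \<xi> k \<omega>)) -` A \<inter> space M" "1 \<le> k" "k \<le> n" "A \<in> sets (replacement_space S)"
  then show thesis by (intro that(2)[of "k - 1" A]) auto
qed (rule that(1) that(3), assumption+)+

lemma U_measurable_history: "k \<le> n \<Longrightarrow> U k \<in> measurable (history n m) (counting_space S)"
  using measurable_space[OF U_measurable[of k]]
  by (intro measurableI) (auto simp: sets_history intro: sigma_sets.Basic history_generatorI)

lemma replacement_measurable_history:
  "k < n \<Longrightarrow> (\<lambda>\<omega>. (C (Suc k) \<omega>, \<xi> (Suc k) \<omega>)) \<in> measurable (history n m) (replacement_space S)"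
  using measurable_space[OF replacement_measurable[of k]]
  by (intro measurableI) (auto simp: sets_history intro: sigma_sets.Basic history_generatorI)

lemma color_measurable_history: "k < m \<Longrightarrow> \<sigma> k \<in> measurable (history n m) S"
  using measurable_space[OF color_measurable[of k]]
  by (intro measurableI) (auto simp: sets_history intro: sigma_sets.Basic history_generatorI)

lemma subalgebra_history: "subalgebra M (history n m)"
  unfolding subalgebra_def
proof
  have "history_generator n m \<subseteq> sets M"
    using measurable_sets[OF U_measurable] measurable_sets[OF replacement_measurable]
      measurable_sets[OF color_measurable] by (auto elim!: history_generatorE)
  then show "sets (history n m) \<subseteq> sets M"
    unfolding sets_history by (rule sets.sigma_sets_subset)
qed simp

lemma subalgebra_history_mono:
  assumes "n \<le> n'" "m \<le> m'"
  shows "subalgebra (history n' m') (history n m)"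
  unfolding subalgebra_def sets_history
proof
  show "sigma_sets (space M) (history_generator n m) \<subseteq> sigma_sets (space M) (history_generator n' m')"
    using assms by (intro sigma_sets_mono' subsetI)
      (auto elim!: history_generatorE intro: history_generatorI)
qed simp

end

subsection \<open>Urns with innovations\<close>

lemma bounded_measurableE:
  assumes "f \<in> bounded_measurable S"
  obtains K where "0 \<le> K" "\<And>x. x \<in> space S \<Longrightarrow> \<bar>f x\<bar> \<le> K" "f \<in> borel_measurable S"
proof -
  obtain K where "\<forall>x\<in>space S. \<bar>f x\<bar> \<le> K" "f \<in> borel_measurable S"
    using assms by (auto simp: bounded_measurable_def bounded_iff)
  then show ?thesis by (intro that[of "max 0 K"]) (auto simp: le_max_iff_disj)
qed

lemma bounded_measurableI:
  fixes f :: "'a \<Rightarrow> real"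
  assumes "f \<in> borel_measurable S" "\<And>x. x \<in> space S \<Longrightarrow> \<bar>f x\<bar> \<le> K"
  shows "f \<in> bounded_measurable S"
  using assms by (auto simp: bounded_measurable_def bounded_iff)

lemma measurable_replacement_space:
  assumes "space S \<noteq> {}" and "f \<in> borel_measurable S"
  shows "(\<lambda>z. real_of_int (fst z)) \<in> borel_measurable (replacement_space S)"
    and "(\<lambda>z. \<integral>x. f x \<partial>snd z :: real) \<in> borel_measurable (replacement_space S)"
  unfolding replacement_space_def
  by (rule measurable_compose[OF measurable_fst], simp)
     (rule measurable_compose[OF measurable_snd measurable_integral_counting_space[OF assms]])

definition jump :: "int \<times> 'a measure \<Rightarrow> real" where
  "jump z = real_of_int (fst z) + total_mass (snd z)"

lemma measurable_jump [measurable]: "jump \<in> borel_measurable (replacement_space S)"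
  unfolding jump_def[abs_def] replacement_space_def
  by (intro borel_measurable_add measurable_compose[OF measurable_fst]
      measurable_compose[OF measurable_snd measurable_total_mass_counting_space]) simp

text \<open>The infima and suprema of the hypotheses are replaced by constants, so that every
  estimate can be made at a single color.\<close>

locale urn_with_innovations = urn_scheme S P u\<^sub>0 M U \<sigma> C \<xi>
  for S :: "'a measure" and P :: "'a \<Rightarrow> (int \<times> 'a measure) measure" and u\<^sub>0 :: "'a measure"
    and M :: "'w measure" and U :: "nat \<Rightarrow> 'w \<Rightarrow> 'a measure" and \<sigma> :: "nat \<Rightarrow> 'w \<Rightarrow> 'a"
    and C :: "nat \<Rightarrow> 'w \<Rightarrow> int" and \<xi> :: "nat \<Rightarrow> 'w \<Rightarrow> 'a measure" +
  fixes \<mu> :: "'a measure" and a :: "'a \<Rightarrow> real" and EC l h \<delta> B :: real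
  assumes kernel: "P \<in> measurable S (prob_algebra (replacement_space S))"
    and initial_counting: "u\<^sub>0 \<in> counting_measures S"
    and initial_nonzero: "emeasure u\<^sub>0 (space u\<^sub>0) \<noteq> 0"
    and jump_nonneg: "\<And>s. s \<in> space S \<Longrightarrow> AE z in P s. 0 \<le> jump z"
    and drift: "\<And>s. s \<in> space S \<Longrightarrow> (\<integral>z. real_of_int (fst z) \<partial>P s) = EC"
    and sets_\<mu>: "sets \<mu> = sets S" and finite_\<mu>: "finite_measure \<mu>"
    and \<mu>_nonzero: "emeasure \<mu> (space \<mu>) \<noteq> 0"
    and a_measurable: "a \<in> borel_measurable S"
    and l_pos: "0 < l" and a_bounds: "\<And>s. s \<in> space S \<Longrightarrow> l \<le> a s" "\<And>s. s \<in> space S \<Longrightarrow> a s \<le> h"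
    and innovation: "\<And>s f. s \<in> space S \<Longrightarrow> f \<in> bounded_measurable S \<Longrightarrow>
           (\<integral>z. (\<integral>x. f x \<partial>snd z) \<partial>P s) = a s * (\<integral>x. f x \<partial>\<mu>)"
    and \<delta>_pos: "0 < \<delta>"
    and growth: "\<And>s. s \<in> space S \<Longrightarrow> \<delta> \<le> measure (P s) {z \<in> space (P s). 1 \<le> jump z}"
    and B_nonneg: "0 \<le> B"
    and second_moment: "\<And>s. s \<in> space S \<Longrightarrow> (\<integral>\<^sup>+z. ennreal ((jump z)\<^sup>2) \<partial>P s) \<le> ennreal B"
begin

text \<open>\<open>T\<close> is the total mass of the urn and \<open>X\<close> its increment; \<open>V f n\<close> is the increment of
  \<open>\<lambda>n. \<integral>x. f x \<partial>U n\<close>, and \<open>compensator f n\<close> its conditional expectation given the history up to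
  step \<open>n\<close>.\<close>

definition replacement :: "nat \<Rightarrow> 'w \<Rightarrow> int \<times> 'a measure" where
  "replacement n \<omega> = (C (Suc n) \<omega>, \<xi> (Suc n) \<omega>)"

definition X :: "nat \<Rightarrow> 'w \<Rightarrow> real" where "X n \<omega> = jump (replacement n \<omega>)"

definition V :: "('a \<Rightarrow> real) \<Rightarrow> nat \<Rightarrow> 'w \<Rightarrow> real" where
  "V f n \<omega> = f (\<sigma> n \<omega>) * real_of_int (C (Suc n) \<omega>) + (\<integral>x. f x \<partial>\<xi> (Suc n) \<omega>)"

definition T :: "nat \<Rightarrow> 'w \<Rightarrow> real" where "T n \<omega> = total_mass (U n \<omega>)"

definition avg :: "('a \<Rightarrow> real) \<Rightarrow> nat \<Rightarrow> 'w \<Rightarrow> real" where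
  "avg f n \<omega> = (\<integral>x. f x \<partial>normalized (U n \<omega>))"

definition compensator :: "('a \<Rightarrow> real) \<Rightarrow> nat \<Rightarrow> 'w \<Rightarrow> real" where
  "compensator f n \<omega> = EC * avg f n \<omega> + avg a n \<omega> * (\<integral>x. f x \<partial>\<mu>)"

definition D :: "('a \<Rightarrow> real) \<Rightarrow> nat \<Rightarrow> 'w \<Rightarrow> real" where
  "D f n \<omega> = V f n \<omega> - compensator f n \<omega>"

lemma S_nonempty: "space S \<noteq> {}"
  using initial_nonzero space_counting_measures[OF initial_counting] by auto

lemma abs_a_le: "x \<in> space S \<Longrightarrow> \<bar>a x\<bar> \<le> h"
  using a_bounds[of x] l_pos by auto

lemma a_bounded: "a \<in> bounded_measurable S"
  by (rule bounded_measurableI[OF a_measurable abs_a_le])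

lemma one_bounded: "(\<lambda>_. 1) \<in> bounded_measurable S"
  by (rule bounded_measurableI[where K=1]) auto

lemma h_nonneg: "0 \<le> h"
  using S_nonempty a_bounds l_pos by (meson all_not_in_conv less_imp_le order_trans)

subsection \<open>Measurability\<close>

lemma replacement_measurable' [measurable]:
  "replacement n \<in> measurable M (replacement_space S)"
  "replacement n \<in> measurable (history (Suc n) m) (replacement_space S)"
  using replacement_measurable replacement_measurable_history[of n "Suc n" m]
  by (simp_all add: replacement_def[abs_def])

lemma kernel_subprob: "P \<in> measurable S (subprob_algebra (replacement_space S))"
  using kernel by (rule measurable_prob_algebraD)

lemma sets_P: "s \<in> space S \<Longrightarrow> sets (P s) = sets (replacement_space S)"
  by (rule sets_kernel[OF kernel_subprob])

lemma prob_space_P: "s \<in> space S \<Longrightarrow> prob_space (P s)"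
  using measurable_space[OF kernel] by (simp add: space_prob_algebra)

lemma replacement_kernel_history:
  "(\<lambda>\<omega>. P (\<sigma> n \<omega>)) \<in> measurable (history n (Suc n)) (subprob_algebra (replacement_space S))"
  by (rule measurable_compose[OF color_measurable_history kernel_subprob]) simp

lemma color_kernel_history:
  "(\<lambda>\<omega>. normalized (U n \<omega>)) \<in> measurable (history n n) (subprob_algebra S)"
  by (rule measurable_compose[OF U_measurable_history measurable_normalized[OF S_nonempty]]) simp

lemmas replacement_nn_integral = cond_law_nn_integral[OF prob_space_axioms subalgebra_history
    replacement_law replacement_measurable replacement_kernel_history, folded replacement_def]

lemmas replacement_cond_exp = cond_law_real_cond_exp[OF prob_space_axioms subalgebra_history
    replacement_law replacement_measurable replacement_kernel_history, folded replacement_def]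

lemmas color_cond_exp = cond_law_real_cond_exp[OF prob_space_axioms subalgebra_history
    color_law color_measurable color_kernel_history]

lemma avg_measurable_history:
  assumes "f \<in> borel_measurable S"
  shows "avg f n \<in> borel_measurable (history n n)"
  unfolding avg_def[abs_def]
  by (rule measurable_compose[OF color_kernel_history integral_measurable_subprob_algebra[OF assms]])

lemma T_measurable_history: "T n \<in> borel_measurable (history n n)"
  unfolding T_def[abs_def]
  by (rule measurable_compose[OF U_measurable_history measurable_total_mass_counting_space]) simp

lemma X_measurable [measurable]: "X n \<in> borel_measurable M"
  unfolding X_def[abs_def] by measurable

lemma parts_measurable_history:
  assumes f: "f \<in> borel_measurable S"
  shows "(\<lambda>\<omega>. real_of_int (C (Suc n) \<omega>)) \<in> borel_measurable (history (Suc n) (Suc n))"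
    and "(\<lambda>\<omega>. \<integral>x. f x \<partial>\<xi> (Suc n) \<omega> :: real) \<in> borel_measurable (history (Suc n) (Suc n))"
    and "(\<lambda>\<omega>. f (\<sigma> n \<omega>)) \<in> borel_measurable (history n (Suc n))"
  using measurable_compose[OF replacement_measurable'(2) measurable_replacement_space(1)[OF S_nonempty f]]
    measurable_compose[OF replacement_measurable'(2) measurable_replacement_space(2)[OF S_nonempty f]]
    measurable_compose[OF color_measurable_history f]
  by (auto simp: replacement_def)

lemma V_measurable_history:
  assumes f: "f \<in> borel_measurable S"
  shows "V f n \<in> borel_measurable (history (Suc n) (Suc n))"
  unfolding V_def[abs_def]
  by (intro borel_measurable_add borel_measurable_times parts_measurable_history[OF f]
      measurable_from_subalg[OF subalgebra_history_mono parts_measurable_history(3)[OF f]]) auto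

lemma compensator_measurable_history:
  assumes "f \<in> borel_measurable S"
  shows "compensator f n \<in> borel_measurable (history n n)"
  unfolding compensator_def[abs_def] using avg_measurable_history[OF assms] avg_measurable_history[OF a_measurable]
  by (intro borel_measurable_add borel_measurable_times) auto

lemma D_measurable_history:
  assumes "f \<in> borel_measurable S"
  shows "D f n \<in> borel_measurable (history (Suc n) (Suc n))"
  unfolding D_def[abs_def]
  by (intro borel_measurable_diff V_measurable_history assms
      measurable_from_subalg[OF subalgebra_history_mono compensator_measurable_history[OF assms]]) auto

subsection \<open>Moment bounds\<close>

lemma color_in_S: "\<omega> \<in> space M \<Longrightarrow> \<sigma> n \<omega> \<in> space S"
  by (rule measurable_space[OF color_measurable])

lemma U_counting: "\<omega> \<in> space M \<Longrightarrow> U n \<omega> \<in> counting_measures S"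
  using measurable_space[OF U_measurable] by (simp add: space_counting_space)

lemma replacement_values:
  assumes "\<omega> \<in> space M"
  shows "-1 \<le> C (Suc n) \<omega>" and "\<xi> (Suc n) \<omega> \<in> counting_measures S"
  using measurable_space[OF replacement_measurable assms, of n]
  by (simp_all add: replacement_space_def space_pair_measure space_counting_space)

lemma X_eq: "X n \<omega> = real_of_int (C (Suc n) \<omega>) + total_mass (\<xi> (Suc n) \<omega>)"
  by (simp add: X_def jump_def replacement_def)

lemma V_one: "V (\<lambda>_. 1) n \<omega> = X n \<omega>"
  by (simp add: V_def X_eq)

lemma X_square: "integrable M (\<lambda>\<omega>. (X n \<omega>)\<^sup>2)" "(\<integral>\<omega>. (X n \<omega>)\<^sup>2 \<partial>M) \<le> B"
proof -
  have "(\<integral>\<^sup>+\<omega>. ennreal ((X n \<omega>)\<^sup>2) \<partial>M) = (\<integral>\<^sup>+\<omega>. (\<integral>\<^sup>+z. ennreal ((jump z)\<^sup>2) \<partial>P (\<sigma> n \<omega>)) \<partial>M)"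
    unfolding X_def by (rule replacement_nn_integral) measurable
  also have "\<dots> \<le> (\<integral>\<^sup>+\<omega>. ennreal B \<partial>M)"
    by (intro nn_integral_mono second_moment color_in_S)
  also have "\<dots> = ennreal B" by (simp add: emeasure_space_1)
  finally have le: "(\<integral>\<^sup>+\<omega>. ennreal ((X n \<omega>)\<^sup>2) \<partial>M) \<le> ennreal B" .
  then show int: "integrable M (\<lambda>\<omega>. (X n \<omega>)\<^sup>2)"
    by (auto simp: integrable_iff_bounded intro: le_less_trans)
  show "(\<integral>\<omega>. (X n \<omega>)\<^sup>2 \<partial>M) \<le> B"
    using le nn_integral_eq_integral[OF int] B_nonneg by simp
qed

text \<open>The almost sure sign passes from each \<open>P s\<close> to the urn by integrating the
  indicator of a negative jump through the conditional law.\<close>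

lemma X_nonneg: "AE \<omega> in M. 0 \<le> X n \<omega>"
proof -
  have "(\<integral>\<^sup>+\<omega>. indicator {z. jump z < 0} (replacement n \<omega>) \<partial>M) =
      (\<integral>\<^sup>+\<omega>. (\<integral>\<^sup>+z. indicator {z. jump z < 0} z \<partial>P (\<sigma> n \<omega>)) \<partial>M)"
    by (rule replacement_nn_integral) measurable
  also have "\<dots> = (\<integral>\<^sup>+\<omega>. 0 \<partial>M)"
  proof (rule nn_integral_cong)
    fix \<omega> assume "\<omega> \<in> space M"
    from jump_nonneg[OF color_in_S[OF this]]
    have "AE z in P (\<sigma> n \<omega>). indicator {z. jump z < 0} z = (0::ennreal)"
      by eventually_elim auto
    then show "(\<integral>\<^sup>+z. indicator {z. jump z < 0} z \<partial>P (\<sigma> n \<omega>)) = 0"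
      by (subst nn_integral_cong_AE) auto
  qed
  finally have "AE \<omega> in M. indicator {z. jump z < 0} (replacement n \<omega>) = (0::ennreal)"
    by (intro nn_integral_0_iff_AE[THEN iffD1] measurable_compose[OF replacement_measurable'(1)]) simp_all
  then show ?thesis
    by eventually_elim (auto simp: X_def indicator_def split: if_splits)
qed

text \<open>All noise terms are dominated by a multiple of |X n| + 2. The bound on the second moment
  is uniform in n and comes from (|x| + 2)^2 \<le> 2 x^2 + 8.\<close>

lemma square_integrable_of_X_bound:
  assumes [measurable]: "Y \<in> borel_measurable M"
    and le: "\<And>\<omega>. \<omega> \<in> space M \<Longrightarrow> \<bar>Y \<omega>\<bar> \<le> L * (\<bar>X n \<omega>\<bar> + 2)"
  shows "integrable M (\<lambda>\<omega>. (Y \<omega>)\<^sup>2)" and "integrable M Y"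
    and "(\<integral>\<omega>. (Y \<omega>)\<^sup>2 \<partial>M) \<le> L\<^sup>2 * (2 * B + 8)"
proof -
  have sq: "(Y \<omega>)\<^sup>2 \<le> L\<^sup>2 * (2 * (X n \<omega>)\<^sup>2 + 8)" if "\<omega> \<in> space M" for \<omega>
  proof -
    have "(Y \<omega>)\<^sup>2 \<le> (L * (\<bar>X n \<omega>\<bar> + 2))\<^sup>2"
      using power_mono[OF le[OF that], of 2] by simp
    also have "\<dots> \<le> L\<^sup>2 * (2 * (X n \<omega>)\<^sup>2 + 8)"
      unfolding power_mult_distrib
      using zero_le_power2[of "\<bar>X n \<omega>\<bar> - 2"]
      by (intro mult_left_mono) (auto simp: power2_sum power2_diff)
    finally show ?thesis .
  qed
  have int_bound: "integrable M (\<lambda>\<omega>. L\<^sup>2 * (2 * (X n \<omega>)\<^sup>2 + 8))"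
    using X_square(1)[of n] by simp
  show int: "integrable M (\<lambda>\<omega>. (Y \<omega>)\<^sup>2)"
    by (rule Bochner_Integration.integrable_bound[OF int_bound]) (use sq in auto)
  then show "integrable M Y" by (rule square_integrable_imp_integrable[rotated]) simp
  have "(\<integral>\<omega>. (Y \<omega>)\<^sup>2 \<partial>M) \<le> (\<integral>\<omega>. L\<^sup>2 * (2 * (X n \<omega>)\<^sup>2 + 8) \<partial>M)"
    by (intro integral_mono int int_bound sq)
  also have "\<dots> = L\<^sup>2 * (2 * (\<integral>\<omega>. (X n \<omega>)\<^sup>2 \<partial>M) + 8)"
    using X_square(1)[of n] by (simp add: prob_space)
  also have "\<dots> \<le> L\<^sup>2 * (2 * B + 8)"
    using X_square(2)[of n] by (intro mult_left_mono) auto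
  finally show "(\<integral>\<omega>. (Y \<omega>)\<^sup>2 \<partial>M) \<le> L\<^sup>2 * (2 * B + 8)" .
qed

text \<open>For C \<ge> 0 the left side is the jump itself. Otherwise C = -1, and changing its sign
  adds 2 to the jump.\<close>

lemma parts_bound:
  assumes "\<omega> \<in> space M"
  shows "\<bar>real_of_int (C (Suc n) \<omega>)\<bar> + total_mass (\<xi> (Suc n) \<omega>) \<le> \<bar>X n \<omega>\<bar> + 2"
proof (cases "0 \<le> C (Suc n) \<omega>")
  case False
  then have "C (Suc n) \<omega> = -1" using replacement_values(1)[OF assms, of n] by simp
  then show ?thesis by (simp add: X_eq)
qed (simp add: X_eq)

lemma V_bound:
  assumes K: "0 \<le> K" "\<And>x. x \<in> space S \<Longrightarrow> \<bar>f x\<bar> \<le> K" and \<omega>: "\<omega> \<in> space M"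
  shows "\<bar>f (\<sigma> n \<omega>) * real_of_int (C (Suc n) \<omega>)\<bar> \<le> K * (\<bar>X n \<omega>\<bar> + 2)"
    and "\<bar>\<integral>x. f x \<partial>\<xi> (Suc n) \<omega>\<bar> \<le> K * (\<bar>X n \<omega>\<bar> + 2)"
    and "\<bar>V f n \<omega>\<bar> \<le> K * (\<bar>X n \<omega>\<bar> + 2)"
proof -
  note \<xi> = replacement_values(2)[OF \<omega>, of n]
  have 1: "\<bar>f (\<sigma> n \<omega>) * real_of_int (C (Suc n) \<omega>)\<bar> \<le> K * \<bar>real_of_int (C (Suc n) \<omega>)\<bar>"
    unfolding abs_mult by (intro mult_right_mono K color_in_S[OF \<omega>]) auto
  have 2: "\<bar>\<integral>x. f x \<partial>\<xi> (Suc n) \<omega>\<bar> \<le> K * total_mass (\<xi> (Suc n) \<omega>)"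
    by (intro abs_integral_le_total_mass finite_counting_measures[OF \<xi>] K)
       (simp add: space_counting_measures[OF \<xi>])
  have 3: "K * \<bar>real_of_int (C (Suc n) \<omega>)\<bar> + K * total_mass (\<xi> (Suc n) \<omega>) \<le> K * (\<bar>X n \<omega>\<bar> + 2)"
    using mult_left_mono[OF parts_bound[OF \<omega>] K(1)] by (simp add: distrib_left)
  have 4: "0 \<le> K * \<bar>real_of_int (C (Suc n) \<omega>)\<bar>" "0 \<le> K * total_mass (\<xi> (Suc n) \<omega>)"
    using K by auto
  show "\<bar>f (\<sigma> n \<omega>) * real_of_int (C (Suc n) \<omega>)\<bar> \<le> K * (\<bar>X n \<omega>\<bar> + 2)"
    "\<bar>\<integral>x. f x \<partial>\<xi> (Suc n) \<omega>\<bar> \<le> K * (\<bar>X n \<omega>\<bar> + 2)"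
    using 1 2 3 4 by linarith+
  show "\<bar>V f n \<omega>\<bar> \<le> K * (\<bar>X n \<omega>\<bar> + 2)"
    unfolding V_def using 1 2 3 by linarith
qed

lemma subprob_normalized: "\<omega> \<in> space M \<Longrightarrow> subprob_space (normalized (U n \<omega>))"
  using color_kernel_history by (rule subprob_space_kernel) simp

lemma sets_normalized_U: "\<omega> \<in> space M \<Longrightarrow> sets (normalized (U n \<omega>)) = sets S"
  using color_kernel_history by (rule sets_kernel) simp

lemma integrable_normalized:
  assumes "\<omega> \<in> space M" "f \<in> bounded_measurable S"
  shows "integrable (normalized (U n \<omega>)) f"
  using subprob_space.axioms(1)[OF subprob_normalized[OF assms(1)]] sets_normalized_U[OF assms(1)] assms(2)
  by (rule integrable_bounded_measurable)

lemma avg_bound: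
  assumes K: "0 \<le> K" "\<And>x. x \<in> space S \<Longrightarrow> \<bar>f x\<bar> \<le> K" and \<omega>: "\<omega> \<in> space M"
  shows "\<bar>avg f n \<omega>\<bar> \<le> K"
proof -
  interpret subprob_space "normalized (U n \<omega>)" by (rule subprob_normalized[OF \<omega>])
  have "\<bar>avg f n \<omega>\<bar> \<le> K * total_mass (normalized (U n \<omega>))"
    unfolding avg_def using sets_eq_imp_space_eq[OF sets_normalized_U[OF \<omega>]]
    by (intro abs_integral_le_total_mass finite_measure_axioms K) simp
  also have "\<dots> \<le> K * 1"
    using subprob_measure_le_1 K(1) by (intro mult_left_mono)
  finally show ?thesis by simp
qed

lemma compensator_bound:
  assumes K: "0 \<le> K" "\<And>x. x \<in> space S \<Longrightarrow> \<bar>f x\<bar> \<le> K" and \<omega>: "\<omega> \<in> space M"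
  shows "\<bar>compensator f n \<omega>\<bar> \<le> \<bar>EC\<bar> * K + h * \<bar>\<integral>x. f x \<partial>\<mu>\<bar>"
proof -
  from avg_bound[where f=a, OF h_nonneg abs_a_le \<omega>, where n=n] avg_bound[where f=f, OF K \<omega>, where n=n]
  have "\<bar>EC\<bar> * \<bar>avg f n \<omega>\<bar> \<le> \<bar>EC\<bar> * K" "\<bar>avg a n \<omega>\<bar> * \<bar>\<integral>x. f x \<partial>\<mu>\<bar> \<le> h * \<bar>\<integral>x. f x \<partial>\<mu>\<bar>"
    by (auto intro: mult_left_mono mult_right_mono)
  then show ?thesis
    unfolding compensator_def
    by (intro order_trans[OF abs_triangle_ineq]) (auto simp: abs_mult)
qed

lemma D_bound:
  assumes "f \<in> bounded_measurable S"
  obtains L where "0 \<le> L" "\<And>n \<omega>. \<omega> \<in> space M \<Longrightarrow> \<bar>D f n \<omega>\<bar> \<le> L * (\<bar>X n \<omega>\<bar> + 2)"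
proof -
  obtain K where K: "0 \<le> K" "\<And>x. x \<in> space S \<Longrightarrow> \<bar>f x\<bar> \<le> K"
    using bounded_measurableE[OF assms] by metis
  define R where "R = \<bar>EC\<bar> * K + h * \<bar>\<integral>x. f x \<partial>\<mu>\<bar>"
  have R: "0 \<le> R" using K h_nonneg by (simp add: R_def)
  have "\<bar>D f n \<omega>\<bar> \<le> (K + R) * (\<bar>X n \<omega>\<bar> + 2)" if "\<omega> \<in> space M" for n \<omega>
  proof -
    have "\<bar>D f n \<omega>\<bar> \<le> K * (\<bar>X n \<omega>\<bar> + 2) + R"
      unfolding D_def R_def using V_bound(3)[where f=f, OF K that, where n=n] compensator_bound[where f=f, OF K that, where n=n] by linarith
    also have "R \<le> R * (\<bar>X n \<omega>\<bar> + 2)"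
      using mult_left_mono[OF _ R, of 1 "\<bar>X n \<omega>\<bar> + 2"] by simp
    finally show ?thesis by (simp add: distrib_right)
  qed
  then show ?thesis using K R by (intro that[of "K + R"]) auto
qed

subsection \<open>Martingale differences\<close>

text \<open>The conditional law of the replacement concerns functions of C and \<xi> alone. Given
  the color, the factor \<open>f (\<sigma> n)\<close> is known and comes out, which leaves the mean
  of C and the innovation formula.\<close>

lemma V_cond_exp_color:
  assumes f: "f \<in> bounded_measurable S"
  shows "AE \<omega> in M. real_cond_exp M (history n (Suc n)) (V f n) \<omega> =
    EC * f (\<sigma> n \<omega>) + a (\<sigma> n \<omega>) * (\<integral>x. f x \<partial>\<mu>)"
proof -
  interpret sigma_finite_subalgebra M "history n (Suc n)"
    by (rule sigma_finite_subalgebra[OF subalgebra_history])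
  obtain K where K: "0 \<le> K" "\<And>x. x \<in> space S \<Longrightarrow> \<bar>f x\<bar> \<le> K" and f_meas: "f \<in> borel_measurable S"
    using bounded_measurableE[OF f] by metis
  note parts = parts_measurable_history[OF f_meas, of n]
  note [measurable] = measurable_from_subalg[OF subalgebra_history parts(1)]
    measurable_from_subalg[OF subalgebra_history parts(2)] measurable_from_subalg[OF subalgebra_history parts(3)]
  have int_C: "integrable M (\<lambda>\<omega>. f (\<sigma> n \<omega>) * real_of_int (C (Suc n) \<omega>))"
    using V_bound(1)[where f=f and n=n, OF K] by (intro square_integrable_of_X_bound(2)[where L=K]) auto
  have int_\<xi>: "integrable M (\<lambda>\<omega>. \<integral>x. f x \<partial>\<xi> (Suc n) \<omega>)"
    using V_bound(2)[where f=f and n=n, OF K] by (intro square_integrable_of_X_bound(2)[where L=K]) auto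
  have "AE \<omega> in M. real_cond_exp M (history n (Suc n)) (\<lambda>\<omega>. real_of_int (fst (replacement n \<omega>))) \<omega> =
      (\<integral>z. real_of_int (fst z) \<partial>P (\<sigma> n \<omega>))"
    using V_bound(1)[where f="\<lambda>_. 1" and K=1 and n=n]
    by (intro replacement_cond_exp measurable_replacement_space(1)[OF S_nonempty f_meas]
        square_integrable_of_X_bound(2)[where L=1]) (auto simp: replacement_def)
  moreover have "AE \<omega> in M. real_cond_exp M (history n (Suc n)) (\<lambda>\<omega>. \<integral>x. f x \<partial>snd (replacement n \<omega>)) \<omega> =
      (\<integral>z. (\<integral>x. f x \<partial>snd z) \<partial>P (\<sigma> n \<omega>))"
    using V_bound(2)[where f=f and n=n, OF K]
    by (intro replacement_cond_exp measurable_replacement_space(2)[OF S_nonempty f_meas]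
        square_integrable_of_X_bound(2)[where L=K]) (auto simp: replacement_def)
  moreover have "AE \<omega> in M. real_cond_exp M (history n (Suc n)) (\<lambda>\<omega>. f (\<sigma> n \<omega>) * real_of_int (C (Suc n) \<omega>)) \<omega> =
      f (\<sigma> n \<omega>) * real_cond_exp M (history n (Suc n)) (\<lambda>\<omega>. real_of_int (C (Suc n) \<omega>)) \<omega>"
    by (rule real_cond_exp_mult[OF parts(3) _ int_C]) measurable
  moreover have "AE \<omega> in M. real_cond_exp M (history n (Suc n)) (V f n) \<omega> =
      real_cond_exp M (history n (Suc n)) (\<lambda>\<omega>. f (\<sigma> n \<omega>) * real_of_int (C (Suc n) \<omega>)) \<omega> +
      real_cond_exp M (history n (Suc n)) (\<lambda>\<omega>. \<integral>x. f x \<partial>\<xi> (Suc n) \<omega>) \<omega>"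
    unfolding V_def[abs_def] by (rule real_cond_exp_add[OF int_C int_\<xi>])
  ultimately show ?thesis using AE_space
  proof eventually_elim
    case (elim \<omega>)
    then show ?case
      using drift[OF color_in_S] innovation[OF color_in_S f] by (simp add: replacement_def mult.commute)
  qed
qed

lemma V_integrable:
  assumes f: "f \<in> bounded_measurable S"
  shows "integrable M (V f n)"
proof -
  obtain K where K: "0 \<le> K" "\<And>x. x \<in> space S \<Longrightarrow> \<bar>f x\<bar> \<le> K" and f_meas: "f \<in> borel_measurable S"
    using bounded_measurableE[OF f] by metis
  show ?thesis
    using V_bound(3)[where f=f and n=n, OF K]
    by (intro square_integrable_of_X_bound(2)[where L=K]
        measurable_from_subalg[OF subalgebra_history V_measurable_history[OF f_meas]]) auto
qed

text \<open>Tower property: once the color is integrated out, the bounded function \<open>w\<close>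
  of it is averaged over the normalized urn, and linearity gives the compensator.\<close>

lemma V_cond_exp:
  assumes f: "f \<in> bounded_measurable S"
  shows "AE \<omega> in M. real_cond_exp M (history n n) (V f n) \<omega> = compensator f n \<omega>"
proof -
  interpret sigma_finite_subalgebra M "history n n"
    by (rule sigma_finite_subalgebra[OF subalgebra_history])
  have [measurable]: "f \<in> borel_measurable S" using bounded_measurableE[OF f] by metis
  note a_measurable [measurable] color_measurable [measurable]
  note V_int = V_integrable[OF f, of n]
  define w where "w s = EC * f s + a s * (\<integral>x. f x \<partial>\<mu>)" for s
  have w: "w \<in> borel_measurable S" unfolding w_def[abs_def] by measurable
  note [measurable] = this
  have "AE \<omega> in M. real_cond_exp M (history n (Suc n)) (V f n) \<omega> = w (\<sigma> n \<omega>)"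
    using V_cond_exp_color[OF f] by (simp add: w_def)
  then have "AE \<omega> in M. real_cond_exp M (history n n) (real_cond_exp M (history n (Suc n)) (V f n)) \<omega> =
      real_cond_exp M (history n n) (\<lambda>\<omega>. w (\<sigma> n \<omega>)) \<omega>"
    by (intro real_cond_exp_cong) auto
  moreover have "AE \<omega> in M. real_cond_exp M (history n n) (real_cond_exp M (history n (Suc n)) (V f n)) \<omega> =
      real_cond_exp M (history n n) (V f n) \<omega>"
    by (intro real_cond_exp_nested_subalg subalgebra_history subalgebra_history_mono V_int) auto
  moreover have "AE \<omega> in M. real_cond_exp M (history n n) (\<lambda>\<omega>. w (\<sigma> n \<omega>)) \<omega> = (\<integral>x. w x \<partial>normalized (U n \<omega>))"
  proof (rule color_cond_exp[OF w])
    have w_b: "w \<in> bounded_measurable S"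
    proof -
      obtain K where K: "\<And>x. x \<in> space S \<Longrightarrow> \<bar>f x\<bar> \<le> K" using bounded_measurableE[OF f] by metis
      have "\<bar>w x\<bar> \<le> \<bar>EC\<bar> * K + h * \<bar>\<integral>x. f x \<partial>\<mu>\<bar>" if "x \<in> space S" for x
        unfolding w_def using K[OF that] abs_a_le[OF that]
        by (intro order_trans[OF abs_triangle_ineq] add_mono) (auto simp: abs_mult intro: mult_left_mono mult_right_mono)
      then show ?thesis by (rule bounded_measurableI[OF w])
    qed
    then obtain K where "\<And>x. x \<in> space S \<Longrightarrow> \<bar>w x\<bar> \<le> K" using bounded_measurableE by metis
    then show "integrable M (\<lambda>\<omega>. w (\<sigma> n \<omega>))"
      by (intro integrable_const_bound[where B=K]) (auto simp: color_in_S)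
  qed
  ultimately show ?thesis using AE_space
  proof eventually_elim
    case (elim \<omega>)
    have "(\<integral>x. w x \<partial>normalized (U n \<omega>)) = compensator f n \<omega>"
      unfolding w_def compensator_def avg_def
      using integrable_normalized[OF elim(4) f, of n] integrable_normalized[OF elim(4) a_bounded, of n]
      by simp
    with elim show ?case by simp
  qed
qed

lemma martingale_differences_D:
  assumes f: "f \<in> bounded_measurable S"
  shows "martingale_differences M (\<lambda>n. history n n) (D f)"
proof
  have f_meas: "f \<in> borel_measurable S" using bounded_measurableE[OF f] by metis
  obtain L where L: "0 \<le> L" "\<And>n \<omega>. \<omega> \<in> space M \<Longrightarrow> \<bar>D f n \<omega>\<bar> \<le> L * (\<bar>X n \<omega>\<bar> + 2)"
    using D_bound[OF f] by blast
  fix n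
  interpret sigma_finite_subalgebra M "history n n"
    by (rule sigma_finite_subalgebra[OF subalgebra_history])
  show "D f n \<in> borel_measurable (history (Suc n) (Suc n))" by (rule D_measurable_history[OF f_meas])
  have [measurable]: "D f n \<in> borel_measurable M"
    by (rule measurable_from_subalg[OF subalgebra_history D_measurable_history[OF f_meas]])
  show "integrable M (\<lambda>\<omega>. (D f n \<omega>)\<^sup>2)"
    by (rule square_integrable_of_X_bound(1)[OF _ L(2)]) auto
  have D_int: "integrable M (D f n)"
    by (rule square_integrable_of_X_bound(2)[OF _ L(2)]) auto
  have comp_int: "integrable M (compensator f n)"
    using Bochner_Integration.integrable_diff[OF V_integrable[OF f, of n] D_int] by (simp add: D_def)
  have "AE \<omega> in M. real_cond_exp M (history n n) (D f n) \<omega> =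
      real_cond_exp M (history n n) (V f n) \<omega> - real_cond_exp M (history n n) (compensator f n) \<omega>"
    unfolding D_def[abs_def] by (intro real_cond_exp_diff V_integrable f comp_int)
  moreover have "AE \<omega> in M. real_cond_exp M (history n n) (compensator f n) \<omega> = compensator f n \<omega>"
    by (intro real_cond_exp_F_meas comp_int compensator_measurable_history f_meas)
  ultimately show "AE \<omega> in M. real_cond_exp M (history n n) (D f n) \<omega> = 0"
    using V_cond_exp[OF f, of n] by eventually_elim simp
qed (auto intro: subalgebra_history subalgebra_history_mono)

lemma weighted_D_summable:
  assumes f: "f \<in> bounded_measurable S"
    and w: "\<And>n. w n \<in> borel_measurable (history n n)"
    and w_le: "\<And>n \<omega>. \<omega> \<in> space M \<Longrightarrow> \<bar>w n \<omega>\<bar> \<le> K / real (Suc n)"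
  shows "AE \<omega> in M. summable (\<lambda>n. w n \<omega> * D f n \<omega>)"
proof -
  interpret martingale_differences M "\<lambda>n. history n n" "D f" by (rule martingale_differences_D[OF f])
  obtain L where L: "0 \<le> L" "\<And>n \<omega>. \<omega> \<in> space M \<Longrightarrow> \<bar>D f n \<omega>\<bar> \<le> L * (\<bar>X n \<omega>\<bar> + 2)"
    using D_bound[OF f] by blast
  have "(\<integral>\<omega>. (D f n \<omega>)\<^sup>2 \<partial>M) \<le> L\<^sup>2 * (2 * B + 8)" for n
    by (rule square_integrable_of_X_bound(3)[OF _ L(2)]) auto
  from summable_weighted_AE[OF w w_le this] show ?thesis .
qed

text \<open>The terms are nonnegative with expectations of order 1/n^2, so the expected sum is
  finite. The series dominates the remainder from the change of denominator.\<close>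

lemma X_square_summable: "AE \<omega> in M. summable (\<lambda>n. (X n \<omega> + 2)\<^sup>2 / (real (Suc n))\<^sup>2)"
proof -
  have int: "integrable M (\<lambda>\<omega>. (X n \<omega> + 2)\<^sup>2)" "(\<integral>\<omega>. (X n \<omega> + 2)\<^sup>2 \<partial>M) \<le> 1\<^sup>2 * (2 * B + 8)" for n
    by (rule square_integrable_of_X_bound[where L=1 and n=n]; auto)+
  have "(\<integral>\<^sup>+\<omega>. (\<Sum>n. ennreal ((X n \<omega> + 2)\<^sup>2 / (real (Suc n))\<^sup>2)) \<partial>M) =
      (\<Sum>n. \<integral>\<^sup>+\<omega>. ennreal ((X n \<omega> + 2)\<^sup>2 / (real (Suc n))\<^sup>2) \<partial>M)"
    by (rule nn_integral_suminf) measurable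
  also have "\<dots> \<le> (\<Sum>n. ennreal ((2 * B + 8) * (1 / (real (Suc n))\<^sup>2)))"
  proof (intro suminf_le summableI)
    fix n
    have "(\<integral>\<^sup>+\<omega>. ennreal ((X n \<omega> + 2)\<^sup>2 / (real (Suc n))\<^sup>2) \<partial>M) =
        ennreal ((\<integral>\<omega>. (X n \<omega> + 2)\<^sup>2 \<partial>M) / (real (Suc n))\<^sup>2)"
      using int(1)[of n] by (subst nn_integral_eq_integral) (auto simp del: of_nat_Suc)
    also have "\<dots> \<le> ennreal ((2 * B + 8) * (1 / (real (Suc n))\<^sup>2))"
      using int(2)[of n] by (intro ennreal_leI) (simp add: divide_right_mono del: of_nat_Suc)
    finally show "(\<integral>\<^sup>+\<omega>. ennreal ((X n \<omega> + 2)\<^sup>2 / (real (Suc n))\<^sup>2) \<partial>M) \<le>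
        ennreal ((2 * B + 8) * (1 / (real (Suc n))\<^sup>2))" .
  qed
  also have "\<dots> = ennreal (\<Sum>n. (2 * B + 8) * (1 / (real (Suc n))\<^sup>2))"
    using B_nonneg by (intro suminf_ennreal2 summable_mult summable_inverse_square_Suc) auto
  also have "\<dots> < \<infinity>" by simp
  finally have "AE \<omega> in M. (\<Sum>n. ennreal ((X n \<omega> + 2)\<^sup>2 / (real (Suc n))\<^sup>2)) \<noteq> \<infinity>"
    by (intro nn_integral_PInf_AE) auto
  then show ?thesis
    by eventually_elim (auto intro!: summable_suminf_not_top)
qed

subsection \<open>Growth of the total mass\<close>

lemma integral_recursion:
  assumes f: "f \<in> bounded_measurable S"
  shows "AE \<omega> in M. (\<integral>x. f x \<partial>U (Suc n) \<omega>) = (\<integral>x. f x \<partial>U n \<omega>) + V f n \<omega>"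
  using recursion[of n] AE_space
proof eventually_elim
  case (elim \<omega>)
  \<comment> \<open>With everything moved to one side, the recursion is a signed combination of four
    finite measures: new urn, old urn, Dirac mass at the color, innovation.\<close>
  define c :: "nat \<Rightarrow> real" where
    "c i = (if i = 0 then 1 else if i = 1 then - 1 else if i = 2 then - real_of_int (C (Suc n) \<omega>) else - 1)" for i
  define \<nu> where "\<nu> i = (if i = 0 then U (Suc n) \<omega> else if i = 1 then U n \<omega>
    else if i = 2 then return S (\<sigma> n \<omega>) else \<xi> (Suc n) \<omega>)" for i :: nat
  note counting = U_counting[OF elim(2)] replacement_values(2)[OF elim(2)]
  have "(\<Sum>i\<in>{0,1,2,3}. c i * (\<integral>x. f x \<partial>\<nu> i)) = 0"
  proof (rule linear_combination_integral_zero[OF _ _ _ _ f])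
    show "finite_measure (\<nu> i)" for i
      using finite_counting_measures[OF counting(1)] finite_counting_measures[OF counting(2)]
        prob_space.finite_measure[OF prob_space_return[OF color_in_S[OF elim(2)]]]
      by (simp add: \<nu>_def)
    show "sets (\<nu> i) = sets S" for i
      using sets_counting_measures[OF counting(1)] sets_counting_measures[OF counting(2)] by (simp add: \<nu>_def)
    show "(\<Sum>i\<in>{0,1,2,3}. c i * measure (\<nu> i) A) = 0" if "A \<in> sets S" for A
      using elim(1) that by (simp add: c_def \<nu>_def measure_return)
  qed simp
  moreover have "f \<in> borel_measurable S" using bounded_measurableE[OF f] by metis
  ultimately have "(\<integral>x. f x \<partial>U (Suc n) \<omega>) - (\<integral>x. f x \<partial>U n \<omega>)
      - f (\<sigma> n \<omega>) * real_of_int (C (Suc n) \<omega>) - (\<integral>x. f x \<partial>\<xi> (Suc n) \<omega>) = 0"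
    using color_in_S[OF elim(2)] by (simp add: c_def \<nu>_def integral_return mult.commute)
  then show ?case by (simp add: V_def)
qed

lemma T_Suc: "AE \<omega> in M. T (Suc n) \<omega> = T n \<omega> + X n \<omega>"
  using integral_recursion[OF one_bounded, of n] by (simp add: T_def V_one)

lemma T_pos: "AE \<omega> in M. \<forall>n. 0 < T n \<omega>"
proof -
  have "AE \<omega> in M. \<forall>n. T (Suc n) \<omega> = T n \<omega> + X n \<omega>" "AE \<omega> in M. \<forall>n. 0 \<le> X n \<omega>"
    using T_Suc X_nonneg by (simp_all add: AE_all_countable)
  with initial show ?thesis
  proof eventually_elim
    case (elim \<omega>)
    interpret finite_measure u\<^sub>0 by (rule finite_counting_measures[OF initial_counting])
    have "0 < T 0 \<omega>"
      using initial_nonzero elim(1) by (simp add: T_def emeasure_eq_measure zero_less_measure_iff)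
    then have "0 < T n \<omega>" for n
      using elim(2,3) by (induction n) (auto intro: add_pos_nonneg)
    then show ?case by simp
  qed
qed

lemma avg_eq:
  assumes "f \<in> borel_measurable S" "\<omega> \<in> space M"
  shows "avg f n \<omega> = (\<integral>x. f x \<partial>U n \<omega>) / T n \<omega>"
  unfolding avg_def T_def using assms sets_counting_measures[OF U_counting[OF assms(2)]]
  by (intro integral_normalized finite_counting_measures[OF U_counting]) (auto cong: measurable_cong_sets)

section \<open>Linear lower bound for the total mass\<close>

definition p :: "'a \<Rightarrow> real" where
  "p s = measure (P s) {z \<in> space (replacement_space S). 1 \<le> jump z}"

definition J :: "nat \<Rightarrow> 'w \<Rightarrow> real" where
  "J n \<omega> = indicator {z \<in> space (replacement_space S). 1 \<le> jump z} (replacement n \<omega>)"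

lemma p_bounds:
  assumes "s \<in> space S"
  shows "\<delta> \<le> p s" "p s \<le> 1"
  using growth[OF assms] sets_eq_imp_space_eq[OF sets_P[OF assms]]
    prob_space.prob_le_1[OF prob_space_P[OF assms]] by (simp_all add: p_def)

text \<open>The centering \<open>p (\<sigma> n)\<close> depends on the color and so need not be
  known at time n. The difference is centered given the color, hence also given the smaller
  history.\<close>

lemma martingale_differences_J:
  "martingale_differences M (\<lambda>n. history n n) (\<lambda>n \<omega>. J n \<omega> - p (\<sigma> n \<omega>))"
proof
  fix n
  let ?G = "history n (Suc n)"
  interpret G: sigma_finite_subalgebra M ?G
    by (rule sigma_finite_subalgebra[OF subalgebra_history])
  interpret H: sigma_finite_subalgebra M "history n n"
    by (rule sigma_finite_subalgebra[OF subalgebra_history])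
  have A: "{z \<in> space (replacement_space S). 1 \<le> jump z} \<in> sets (replacement_space S)" by measurable
  have p_meas: "p \<in> borel_measurable S"
    unfolding p_def[abs_def] by (rule measurable_compose[OF kernel_subprob measurable_measure_subprob_algebra[OF A]])
  have p_G: "(\<lambda>\<omega>. p (\<sigma> n \<omega>)) \<in> borel_measurable ?G"
    by (rule measurable_compose[OF color_measurable_history p_meas]) simp
  have J_H: "J n \<in> borel_measurable (history (Suc n) (Suc n))"
    unfolding J_def[abs_def] using A by (intro measurable_compose[OF replacement_measurable'(2)]) auto
  have J_M [measurable]: "J n \<in> borel_measurable M" by (rule measurable_from_subalg[OF subalgebra_history J_H])
  have p_M [measurable]: "(\<lambda>\<omega>. p (\<sigma> n \<omega>)) \<in> borel_measurable M" by (rule measurable_from_subalg[OF subalgebra_history p_G])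
  show "(\<lambda>\<omega>. J n \<omega> - p (\<sigma> n \<omega>)) \<in> borel_measurable (history (Suc n) (Suc n))"
    using J_H by (rule borel_measurable_diff) (rule measurable_from_subalg[OF subalgebra_history_mono p_G], auto)
  have J_int: "integrable M (J n)"
    by (rule integrable_const_bound[where B=1]) (auto simp: J_def indicator_def)
  have p_int: "integrable M (\<lambda>\<omega>. p (\<sigma> n \<omega>))"
  proof (rule integrable_const_bound[where B=1, OF AE_I2])
    show "norm (p (\<sigma> n \<omega>)) \<le> 1" if "\<omega> \<in> space M" for \<omega>
      using p_bounds[OF color_in_S[OF that], of n] \<delta>_pos by simp
  qed simp
  have "AE \<omega> in M. real_cond_exp M ?G (J n) \<omega> = p (\<sigma> n \<omega>)"
  proof -
    have "AE \<omega> in M. real_cond_exp M ?G (\<lambda>\<omega>. indicator {z \<in> space (replacement_space S). 1 \<le> jump z} (replacement n \<omega>)) \<omega> =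
        (\<integral>z. indicator {z \<in> space (replacement_space S). 1 \<le> jump z} z \<partial>P (\<sigma> n \<omega>))"
      using J_int A unfolding J_def[abs_def] by (intro replacement_cond_exp) auto
    then show ?thesis
      using AE_space
    proof eventually_elim
      case (elim \<omega>)
      then show ?case
        using sets_eq_imp_space_eq[OF sets_P[OF color_in_S[OF elim(2)]]]
        by (simp add: p_def Int_absorb2 J_def[abs_def])
    qed
  qed
  moreover have "AE \<omega> in M. real_cond_exp M ?G (\<lambda>\<omega>. J n \<omega> - p (\<sigma> n \<omega>)) \<omega> =
      real_cond_exp M ?G (J n) \<omega> - real_cond_exp M ?G (\<lambda>\<omega>. p (\<sigma> n \<omega>)) \<omega>"
    by (intro G.real_cond_exp_diff J_int p_int)
  moreover have "AE \<omega> in M. real_cond_exp M ?G (\<lambda>\<omega>. p (\<sigma> n \<omega>)) \<omega> = p (\<sigma> n \<omega>)"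
    by (intro G.real_cond_exp_F_meas p_int p_G)
  ultimately have "AE \<omega> in M. real_cond_exp M ?G (\<lambda>\<omega>. J n \<omega> - p (\<sigma> n \<omega>)) \<omega> = 0"
    by eventually_elim simp
  then have "AE \<omega> in M. real_cond_exp M (history n n) (real_cond_exp M ?G (\<lambda>\<omega>. J n \<omega> - p (\<sigma> n \<omega>))) \<omega> =
      real_cond_exp M (history n n) (\<lambda>_. 0) \<omega>"
    by (intro H.real_cond_exp_cong) auto
  moreover have "AE \<omega> in M. real_cond_exp M (history n n) (real_cond_exp M ?G (\<lambda>\<omega>. J n \<omega> - p (\<sigma> n \<omega>))) \<omega> =
      real_cond_exp M (history n n) (\<lambda>\<omega>. J n \<omega> - p (\<sigma> n \<omega>)) \<omega>"
    using J_int p_int by (intro H.real_cond_exp_nested_subalg subalgebra_history subalgebra_history_mono) auto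
  moreover have "AE \<omega> in M. real_cond_exp M (history n n) (\<lambda>_. 0) \<omega> = 0"
    by (intro H.real_cond_exp_F_meas) auto
  ultimately show "AE \<omega> in M. real_cond_exp M (history n n) (\<lambda>\<omega>. J n \<omega> - p (\<sigma> n \<omega>)) \<omega> = 0"
    by eventually_elim simp
  have "\<bar>J n \<omega> - p (\<sigma> n \<omega>)\<bar> \<le> 1 * (\<bar>X n \<omega>\<bar> + 2)" if "\<omega> \<in> space M" for \<omega>
    using p_bounds[OF color_in_S[OF that], of n] \<delta>_pos by (auto simp: J_def indicator_def)
  then show "integrable M (\<lambda>\<omega>. (J n \<omega> - p (\<sigma> n \<omega>))\<^sup>2)"
    by (intro square_integrable_of_X_bound(1)[where L=1 and n=n]) auto
qed (auto intro: subalgebra_history subalgebra_history_mono)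

text \<open>Since J \<le> X, the mass dominates the number of jumps of size at least 1. By
  Kronecker's lemma this number differs from the sum of the probabilities, at least \<delta> n, by
  less than \<delta> n/2 eventually. The last factor 2, from \<delta>/2 to \<delta>/4, pays for
  passing from n to n + 1.\<close>

lemma T_lower: "AE \<omega> in M. \<forall>\<^sub>F n in sequentially. \<delta> / 4 * real (Suc n) \<le> T n \<omega>"
proof -
  interpret martingale_differences M "\<lambda>n. history n n" "\<lambda>n \<omega>. J n \<omega> - p (\<sigma> n \<omega>)"
    by (rule martingale_differences_J)
  have "\<bar>J n \<omega> - p (\<sigma> n \<omega>)\<bar> \<le> 1 * (\<bar>X n \<omega>\<bar> + 2)" if "\<omega> \<in> space M" for n \<omega>
    using p_bounds[OF color_in_S[OF that], of n] \<delta>_pos by (auto simp: J_def indicator_def)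
  then have "(\<integral>\<omega>. (J n \<omega> - p (\<sigma> n \<omega>))\<^sup>2 \<partial>M) \<le> 1\<^sup>2 * (2 * B + 8)" for n
    by (intro square_integrable_of_X_bound(3)[where n=n]) auto
  then have "AE \<omega> in M. summable (\<lambda>n. 1 / real (Suc n) * (J n \<omega> - p (\<sigma> n \<omega>)))"
    by (intro summable_weighted_AE[where K=1]) auto
  moreover have "AE \<omega> in M. \<forall>n. T (Suc n) \<omega> = T n \<omega> + X n \<omega>" "AE \<omega> in M. \<forall>n. 0 \<le> X n \<omega>"
    using T_Suc X_nonneg by (simp_all add: AE_all_countable)
  ultimately show ?thesis using T_pos AE_space
  proof eventually_elim
    case (elim \<omega>)
    have J_X: "J n \<omega> \<le> X n \<omega>" for n
      using elim(3) by (auto simp: J_def X_def indicator_def)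
    have T_J: "(\<Sum>k<n. J k \<omega>) \<le> T n \<omega>" for n
    proof (induction n)
      case (Suc n)
      then show ?case using J_X[of n] elim(2) by simp
    qed (use elim(4) in \<open>simp add: less_imp_le\<close>)
    have p_sum: "real n * \<delta> \<le> (\<Sum>k<n. p (\<sigma> k \<omega>))" for n
      using sum_bounded_below[of "{..<n}" \<delta> "\<lambda>k. p (\<sigma> k \<omega>)"] p_bounds(1)[OF color_in_S[OF elim(5)]] by simp
    have "(\<lambda>n. (\<Sum>k<n. J k \<omega> - p (\<sigma> k \<omega>)) / real n) \<longlonglongrightarrow> 0"
      using elim(1) by (intro kronecker_average) simp
    then have "\<forall>\<^sub>F n in sequentially. - (\<delta> / 2) < (\<Sum>k<n. J k \<omega> - p (\<sigma> k \<omega>)) / real n"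
      by (rule order_tendstoD(1)) (use \<delta>_pos in simp)
    then show ?case using eventually_gt_at_top[of 0]
    proof eventually_elim
      case (elim n)
      then have "- (\<delta> / 2) * real n < (\<Sum>k<n. J k \<omega>) - (\<Sum>k<n. p (\<sigma> k \<omega>))"
        by (simp add: pos_less_divide_eq sum_subtractf)
      with p_sum[of n] T_J[of n] have "\<delta> / 2 * real n \<le> T n \<omega>" by (simp add: mult.commute)
      moreover have "\<delta> / 4 * real (Suc n) \<le> \<delta> / 2 * real n"
        using elim(2) \<delta>_pos by (simp add: field_simps)
      ultimately show ?case by linarith
    qed
  qed
qed

lemma T_recursion_D: "AE \<omega> in M. \<forall>n. T (Suc n) \<omega> = T n \<omega> + D (\<lambda>_. 1) n \<omega> + compensator (\<lambda>_. 1) n \<omega>"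
  using T_Suc by (simp add: AE_all_countable D_def V_one)

lemma D_average_summable:
  assumes "f \<in> bounded_measurable S"
  shows "AE \<omega> in M. summable (\<lambda>n. D f n \<omega> / real (Suc n))"
  using weighted_D_summable[OF assms, where w="\<lambda>n _. 1 / real (Suc n)" and K=1] by simp

text \<open>The compensators are bounded by a constant \<open>R\<close> and the martingale part is
  eventually below n, so \<open>T 0 + 1 + R\<close> serves as the factor.\<close>

lemma T_upper: "AE \<omega> in M. \<exists>K. \<forall>\<^sub>F n in sequentially. T n \<omega> \<le> K * real (Suc n)"
  using D_average_summable[OF one_bounded] T_recursion_D AE_space
proof eventually_elim
  case (elim \<omega>)
  define R where "R = \<bar>EC\<bar> * 1 + h * \<bar>\<integral>x. 1 \<partial>\<mu>\<bar>"
  have R: "compensator (\<lambda>_. 1) n \<omega> \<le> R" for n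
    using compensator_bound[where K=1 and f="\<lambda>_. 1" and \<omega>=\<omega> and n=n] elim(3) unfolding R_def by auto
  have le: "T n \<omega> \<le> T 0 \<omega> + (\<Sum>k<n. D (\<lambda>_. 1) k \<omega>) + real n * R" for n
  proof (induction n)
    case (Suc n)
    then show ?case using elim(2) R[of n] by (simp add: algebra_simps)
  qed simp
  have "\<forall>\<^sub>F n in sequentially. (\<Sum>k<n. D (\<lambda>_. 1) k \<omega>) / real n < 1"
    using kronecker_average[OF elim(1)] by (rule order_tendstoD(2)) simp
  then have "\<forall>\<^sub>F n in sequentially. T n \<omega> \<le> (T 0 \<omega> + 1 + R) * real (Suc n)"
    using eventually_gt_at_top[of 0]
  proof eventually_elim
    case (elim n)
    then have "(\<Sum>k<n. D (\<lambda>_. 1) k \<omega>) \<le> real n" by simp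
    moreover have "0 \<le> T 0 \<omega>" by (simp add: T_def)
    moreover have "0 \<le> R" using h_nonneg by (simp add: R_def)
    moreover have "(T 0 \<omega> + 1 + R) * real (Suc n) = T 0 \<omega> + 1 + R + real n * T 0 \<omega> + real n + real n * R"
      by (simp add: algebra_simps)
    moreover have "0 \<le> real n * T 0 \<omega>" by (simp add: T_def)
    ultimately show ?case using le[of n] by linarith
  qed
  then show ?case by blast
qed

subsection \<open>Convergence of the averages\<close>

lemma avg_one: "0 < T n \<omega> \<Longrightarrow> \<omega> \<in> space M \<Longrightarrow> avg (\<lambda>_. 1) n \<omega> = 1"
  by (simp add: avg_eq T_def[symmetric])

text \<open>The lower bound rests on the normalized urn having mass 1; for the empty urn the average
  would be 0.\<close>

lemma avg_a_bounds:
  assumes "0 < T n \<omega>" and \<omega>: "\<omega> \<in> space M"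
  shows "l \<le> avg a n \<omega>" and "avg a n \<omega> \<le> h"
proof -
  note int = integrable_normalized[OF \<omega> one_bounded, of n]
  have "l * avg (\<lambda>_. 1) n \<omega> = (\<integral>x. l * 1 \<partial>normalized (U n \<omega>))"
    unfolding avg_def by simp
  also have "\<dots> \<le> avg a n \<omega>"
    unfolding avg_def using sets_eq_imp_space_eq[OF sets_normalized_U[OF \<omega>]]
    by (intro integral_mono integrable_mult_right int integrable_normalized \<omega> a_bounded) (simp add: a_bounds)
  finally show "l \<le> avg a n \<omega>" using avg_one[OF assms] by simp
  show "avg a n \<omega> \<le> h" using avg_bound[where f=a, OF h_nonneg abs_a_le \<omega>] by (rule abs_le_D1)
qed

lemma \<mu>_one_pos: "0 < (\<integral>x. 1 \<partial>\<mu> :: real)"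
proof -
  interpret \<mu>: finite_measure \<mu> by (rule finite_\<mu>)
  show ?thesis using \<mu>_nonzero by (simp add: \<mu>.emeasure_eq_measure zero_less_measure_iff)
qed

lemma centered_average_tendsto_zero:
  assumes g: "g \<in> bounded_measurable S" and centered: "(\<integral>x. g x \<partial>\<mu>) = 0"
  shows "AE \<omega> in M. (\<lambda>n. avg g n \<omega>) \<longlonglongrightarrow> 0"
proof -
  define m where "m = (\<integral>x. 1 \<partial>\<mu> :: real)"
  obtain K where K: "0 \<le> K" "\<And>x. x \<in> space S \<Longrightarrow> \<bar>g x\<bar> \<le> K" and g_meas: "g \<in> borel_measurable S"
    using bounded_measurableE[OF g] by metis
  \<comment> \<open>A truncation of \<open>1 / T n\<close>: bounded by a deterministic multiple of
    1/(n + 1) everywhere, and equal to \<open>1 / T n\<close> from the time on when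
    \<open>T_lower\<close> takes effect.\<close>
  define w where "w n \<omega> = 1 / max (T n \<omega>) (\<delta> / 4 * real (Suc n))" for n \<omega>
  have w_meas: "w n \<in> borel_measurable (history n n)" for n
    unfolding w_def[abs_def] using T_measurable_history[of n] by measurable
  have w_bound: "\<bar>w n \<omega>\<bar> \<le> (4 / \<delta>) / real (Suc n)" for n \<omega>
  proof -
    have pos: "0 < \<delta> / 4 * real (Suc n)" using \<delta>_pos by simp
    have "\<bar>w n \<omega>\<bar> = 1 / max (T n \<omega>) (\<delta> / 4 * real (Suc n))"
      using pos by (simp add: w_def less_max_iff_disj)
    also have "\<dots> \<le> 1 / (\<delta> / 4 * real (Suc n))"
      using pos by (intro divide_left_mono mult_pos_pos) (use \<delta>_pos in \<open>auto simp: less_max_iff_disj\<close>)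
    finally show ?thesis by simp
  qed
  have "AE \<omega> in M. summable (\<lambda>n. w n \<omega> * D g n \<omega>)"
    by (rule weighted_D_summable[OF g w_meas w_bound])
  moreover have "AE \<omega> in M. summable (\<lambda>n. (w n \<omega> * avg g n \<omega>) * D (\<lambda>_. 1) n \<omega>)"
  proof (rule weighted_D_summable[OF one_bounded])
    show "(\<lambda>\<omega>. w n \<omega> * avg g n \<omega>) \<in> borel_measurable (history n n)" for n
      using w_meas avg_measurable_history[OF g_meas] by (rule borel_measurable_times)
    show "\<bar>w n \<omega> * avg g n \<omega>\<bar> \<le> (4 / \<delta> * K) / real (Suc n)" if "\<omega> \<in> space M" for n \<omega>
      using mult_mono[OF w_bound avg_bound[where f=g, OF K that]] \<delta>_pos by (simp add: abs_mult)
  qed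
  moreover have "AE \<omega> in M. \<forall>n. (\<integral>x. g x \<partial>U (Suc n) \<omega>) = (\<integral>x. g x \<partial>U n \<omega>) + V g n \<omega>"
    using integral_recursion[OF g] by (simp add: AE_all_countable)
  moreover have "AE \<omega> in M. \<forall>n. T (Suc n) \<omega> = T n \<omega> + X n \<omega>" "AE \<omega> in M. \<forall>n. 0 \<le> X n \<omega>"
    using T_Suc X_nonneg by (simp_all add: AE_all_countable)
  ultimately show ?thesis using T_pos T_lower T_upper X_square_summable AE_space
  proof eventually_elim
    case (elim \<omega>)
    \<comment> \<open>The martingale part of \<open>V g n - avg g n * X n\<close>. Since
      \<open>avg g n\<close> is known at time n, both terms are martingale differences with
      admissible weights.\<close>
    define N where "N n = D g n \<omega> - avg g n \<omega> * D (\<lambda>_. 1) n \<omega>" for n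
    define b where "b n = avg a n \<omega> * m" for n
    have T: "0 < T n \<omega>" "T (Suc n) \<omega> = T n \<omega> + X n \<omega>" "0 \<le> X n \<omega>" for n
      using elim by auto
    obtain K' where upper: "\<forall>\<^sub>F n in sequentially. T n \<omega> \<le> K' * real (Suc n)" using elim(8) by blast
    \<comment> \<open>Since \<mu>(g) = 0, the compensator of \<open>V g n\<close> is
      \<open>EC * avg g n\<close>, while that of \<open>X n\<close> is \<open>EC + b n\<close>. In
      the difference the two terms with \<open>EC\<close> cancel, leaving the restoring drift
      \<open>- b n * avg g n\<close>.\<close>
    have increment: "N n - b n * avg g n \<omega> = V g n \<omega> - avg g n \<omega> * X n \<omega>" for n
      by (simp add: N_def D_def V_one compensator_def centered b_def m_def avg_one[OF T(1) elim(10)] algebra_simps)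
    show ?case
    proof (rule recursion_ratio_tendsto_zero[where T="\<lambda>n. T n \<omega>" and X="\<lambda>n. X n \<omega>" and N=N and b=b
        and \<kappa>="\<delta> / 4" and K=K' and ?b0.0="l * m" and ?b1.0="h * m" and L="2 * K"])
      fix n
      have "avg g (Suc n) \<omega> = (avg g n \<omega> * T n \<omega> + V g n \<omega>) / T (Suc n) \<omega>"
        using elim(3) T(1)[of n] by (simp add: avg_eq[OF g_meas elim(10)])
      also have "\<dots> = avg g n \<omega> + (V g n \<omega> - avg g n \<omega> * X n \<omega>) / T (Suc n) \<omega>"
        using T(1)[of "Suc n"] by (simp add: T(2) field_simps)
      finally show "avg g (Suc n) \<omega> = avg g n \<omega> + (N n - b n * avg g n \<omega>) / T (Suc n) \<omega>"
        by (simp add: increment)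
      \<comment> \<open>One \<open>K\<close> bounds this product and another bounds
        \<open>V g n\<close>, whence the constant \<open>2 * K\<close>.\<close>
      have "\<bar>avg g n \<omega> * X n \<omega>\<bar> \<le> K * (X n \<omega> + 2)"
        unfolding abs_mult using avg_bound[where f=g and n=n, OF K elim(10)] T(3)[of n] K by (intro mult_mono) auto
      then have "\<bar>V g n \<omega> - avg g n \<omega> * X n \<omega>\<bar> \<le> K * (X n \<omega> + 2) + K * (X n \<omega> + 2)"
        using V_bound(3)[where f=g and n=n, OF K elim(10)] T(3)[of n] by simp
      then show "\<bar>N n - b n * avg g n \<omega>\<bar> \<le> (2 * K) * (X n \<omega> + 2)"
        by (simp add: increment)
      show "l * m \<le> b n" "b n \<le> h * m"
        unfolding b_def using avg_a_bounds[OF T(1) elim(10)] \<mu>_one_pos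
        by (auto simp: m_def intro: mult_right_mono)
    next
      have "\<forall>\<^sub>F n in sequentially. w n \<omega> * D g n \<omega> - (w n \<omega> * avg g n \<omega>) * D (\<lambda>_. 1) n \<omega> = N n / T n \<omega>"
        using elim(7) by eventually_elim (simp add: w_def N_def max.absorb1 diff_divide_distrib)
      then show "summable (\<lambda>n. N n / T n \<omega>)"
        using summable_diff[OF elim(1,2)] by (simp add: summable_cong)
    qed (use T elim upper l_pos \<delta>_pos \<mu>_one_pos in \<open>auto simp: m_def\<close>)
  qed
qed

text \<open>Subtracting the normalized \<mu>-mean \<open>c\<close> from f gives a function with
  \<mu>-integral 0, to which the centered case applies.\<close>

lemma average_tendsto:
  assumes f: "f \<in> bounded_measurable S"
  shows "AE \<omega> in M. (\<lambda>n. avg f n \<omega>) \<longlonglongrightarrow> (\<integral>x. f x \<partial>normalized \<mu>)"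
proof -
  interpret \<mu>: finite_measure \<mu> by (rule finite_\<mu>)
  define c where "c = (\<integral>x. f x \<partial>normalized \<mu>)"
  obtain K where K: "0 \<le> K" "\<And>x. x \<in> space S \<Longrightarrow> \<bar>f x\<bar> \<le> K" and f_meas: "f \<in> borel_measurable S"
    using bounded_measurableE[OF f] by metis
  have c: "c = (\<integral>x. f x \<partial>\<mu>) / (\<integral>x. 1 \<partial>\<mu>)"
    unfolding c_def using f_meas sets_\<mu>
    by (subst integral_normalized[OF finite_\<mu>]) (auto cong: measurable_cong_sets)
  have g: "(\<lambda>x. f x - c) \<in> bounded_measurable S"
  proof (rule bounded_measurableI)
    show "(\<lambda>x. f x - c) \<in> borel_measurable S" using f_meas by simp
    show "\<bar>f x - c\<bar> \<le> K + \<bar>c\<bar>" if "x \<in> space S" for x using K(2)[OF that] by linarith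
  qed
  have "(\<integral>x. f x - c \<partial>\<mu>) = (\<integral>x. f x \<partial>\<mu>) - c * (\<integral>x. 1 \<partial>\<mu>)"
    using integrable_bounded_measurable[OF finite_\<mu> sets_\<mu> f] by simp
  also have "\<dots> = 0" using \<mu>_one_pos by (simp add: c)
  finally have "AE \<omega> in M. (\<lambda>n. avg (\<lambda>x. f x - c) n \<omega>) \<longlonglongrightarrow> 0"
    by (rule centered_average_tendsto_zero[OF g])
  then show ?thesis using T_pos AE_space
  proof eventually_elim
    case (elim \<omega>)
    have "avg (\<lambda>x. f x - c) n \<omega> = avg f n \<omega> - c" for n
    proof -
      \<comment> \<open>The constant is kept as \<open>c * 1\<close> so that its integral is
        \<open>c\<close> times the average of 1, which equals 1 because the urn is nonempty.\<close>
      have "(\<integral>x. f x - c * 1 \<partial>normalized (U n \<omega>)) = avg f n \<omega> - (\<integral>x. c * 1 \<partial>normalized (U n \<omega>))"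
        unfolding avg_def
        by (intro Bochner_Integration.integral_diff integrable_mult_right integrable_normalized[OF elim(3)]
            f one_bounded)
      also have "(\<integral>x. c * 1 \<partial>normalized (U n \<omega>)) = c * avg (\<lambda>_. 1) n \<omega>"
        unfolding avg_def by (rule integral_mult_right_zero)
      finally have "avg (\<lambda>x. f x - c) n \<omega> = avg f n \<omega> - c * avg (\<lambda>_. 1) n \<omega>"
        by (simp only: avg_def mult_1_right)
      then show ?thesis using avg_one elim(2,3) by simp
    qed
    with elim(1) show ?case by (simp add: LIM_zero_iff c_def)
  qed
qed

text \<open>The drift of the mass is \<open>EC\<close> plus \<mu>(1) times the average of
  \<open>a\<close>. The limit of this average is \<mu>(a)/\<mu>(1), so the factor \<mu>(1)
  cancels.\<close>

lemma total_mass_tendsto: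
  "AE \<omega> in M. (\<lambda>n. T n \<omega> / real n) \<longlonglongrightarrow> EC + (\<integral>x. a x \<partial>\<mu>)"
  using average_tendsto[OF a_bounded] D_average_summable[OF one_bounded] T_recursion_D T_pos AE_space
proof eventually_elim
  case (elim \<omega>)
  have "(\<lambda>n. compensator (\<lambda>_. 1) n \<omega>) \<longlonglongrightarrow> EC * 1 + (\<integral>x. a x \<partial>normalized \<mu>) * (\<integral>x. 1 \<partial>\<mu>)"
    unfolding compensator_def using elim(4,5)
    by (intro tendsto_intros elim(1)) (simp add: avg_one)
  also have "EC * 1 + (\<integral>x. a x \<partial>normalized \<mu>) * (\<integral>x. 1 \<partial>\<mu>) = EC + (\<integral>x. a x \<partial>\<mu>)"
    using a_measurable sets_\<mu> \<mu>_one_pos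
    by (subst integral_normalized[OF finite_\<mu>]) (auto cong: measurable_cong_sets)
  finally show ?case using elim(2,3) by (intro recursion_average) auto
qed

lemma integral_tendsto:
  assumes f: "f \<in> bounded_measurable S"
  shows "AE \<omega> in M. (\<lambda>n. (\<integral>x. f x \<partial>U n \<omega>) / real n)
    \<longlonglongrightarrow> (EC + (\<integral>x. a x \<partial>\<mu>)) * (\<integral>x. f x \<partial>normalized \<mu>)"
  using average_tendsto[OF f] total_mass_tendsto T_pos AE_space
proof eventually_elim
  case (elim \<omega>)
  have "f \<in> borel_measurable S" using bounded_measurableE[OF f] by metis
  then have eq: "(\<integral>x. f x \<partial>U n \<omega>) / real n = T n \<omega> / real n * avg f n \<omega>" for n
    using elim(3) less_imp_neq[of 0 "T n \<omega>"] by (simp add: avg_eq[OF _ elim(4)])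
  show ?case unfolding eq by (rule tendsto_mult[OF elim(2,1)])
qed

end

section \<open>Limits under the original hypotheses\<close>

theorem theorem1:
  fixes S :: "'a measure" and P :: "'a \<Rightarrow> (int \<times> 'a measure) measure"
    and u\<^sub>0 \<mu> :: "'a measure" and a :: "'a \<Rightarrow> real" and EC lambda1 :: real
    and M :: "'w measure" and U :: "nat \<Rightarrow> 'w \<Rightarrow> 'a measure" and \<sigma> :: "nat \<Rightarrow> 'w \<Rightarrow> 'a"
    and C :: "nat \<Rightarrow> 'w \<Rightarrow> int" and \<xi> :: "nat \<Rightarrow> 'w \<Rightarrow> 'a measure"
  assumes "borel_space S"
    and "P \<in> measurable S (prob_algebra (replacement_space S))"
    and "u\<^sub>0 \<in> counting_measures S" and "emeasure u\<^sub>0 (space u\<^sub>0) \<noteq> 0"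
    and "urn_scheme S P u\<^sub>0 M U \<sigma> C \<xi>"
    and "\<And>s. s \<in> space S \<Longrightarrow>
           measure (P s) {(k, \<nu>) \<in> space (P s). real_of_int k + total_mass \<nu> \<ge> 0} = 1"
    and "\<And>s. s \<in> space S \<Longrightarrow> (\<integral>(k, \<nu>). real_of_int k \<partial>P s) = EC"
    and "sets \<mu> = sets S" and "finite_measure \<mu>" and "emeasure \<mu> (space \<mu>) \<noteq> 0"
    and "a \<in> borel_measurable S"
    and "\<exists>l>0. \<exists>u. \<forall>s\<in>space S. l \<le> a s \<and> a s \<le> u"
    and "\<And>s f. s \<in> space S \<Longrightarrow> f \<in> bounded_measurable S \<Longrightarrow>
           (\<integral>(k, \<nu>). (\<integral>x. f x \<partial>\<nu>) \<partial>P s) = a s * (\<integral>x. f x \<partial>\<mu>)"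
    and "0 < (INF s\<in>space S.
           measure (P s) {(k, \<nu>) \<in> space (P s). real_of_int k + total_mass \<nu> \<ge> 1})"
    and "(SUP s\<in>space S.
           (\<integral>\<^sup>+(k, \<nu>). ennreal ((real_of_int k + total_mass \<nu>)\<^sup>2) \<partial>P s)) < \<infinity>"
    and "lambda1 = EC + (\<integral>s. a s \<partial>\<mu>)"
  shows "(\<forall>f\<in>bounded_measurable S.
            AE \<omega> in M. (\<lambda>n. (\<integral>x. f x \<partial>U n \<omega>) / real n)
              \<longlonglongrightarrow> lambda1 * (\<integral>x. f x \<partial>normalized \<mu>)) \<and>
         (\<forall>f\<in>bounded_measurable S.
            AE \<omega> in M. (\<lambda>n. \<integral>x. f x \<partial>normalized (U n \<omega>))
              \<longlonglongrightarrow> (\<integral>x. f x \<partial>normalized \<mu>))"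
proof -
  obtain l h where l: "0 < l" and lh: "\<And>s. s \<in> space S \<Longrightarrow> l \<le> a s" "\<And>s. s \<in> space S \<Longrightarrow> a s \<le> h"
    using assms(12) by blast
  define \<delta> where "\<delta> = (INF s\<in>space S. measure (P s) {z \<in> space (P s). 1 \<le> jump z})"
  have jump_sets: "{(k, \<nu>) \<in> space (P s). real_of_int k + total_mass \<nu> \<ge> r} = {z \<in> space (P s). r \<le> jump z}" for s r
    by (auto simp: jump_def)
  \<comment> \<open>The supremum is an extended nonnegative real; being finite, it survives the
    conversion to a real constant.\<close>
  define B where "B = (SUP s\<in>space S. (\<integral>\<^sup>+z. ennreal ((jump z)\<^sup>2) \<partial>P s))"
  have "B < \<infinity>"
    using assms(15) by (simp add: B_def jump_def case_prod_beta')
  then have B: "ennreal (enn2real B) = B" by simp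
  interpret urn_with_innovations S P u\<^sub>0 M U \<sigma> C \<xi> \<mu> a EC l h \<delta> "enn2real B"
  proof (intro urn_with_innovations.intro urn_with_innovations_axioms.intro)
    fix s assume s: "s \<in> space S"
    have "prob_space (P s)"
      using measurable_space[OF assms(2) s] by (simp add: space_prob_algebra)
    from prob_space.AE_prob_1[OF this assms(6)[OF s, unfolded jump_sets]]
    show "AE z in P s. 0 \<le> jump z" by eventually_elim simp
    show "(\<integral>z. real_of_int (fst z) \<partial>P s) = EC"
      using assms(7)[OF s] by (simp add: case_prod_beta')
    show "(\<integral>z. (\<integral>x. f x \<partial>snd z) \<partial>P s) = a s * (\<integral>x. f x \<partial>\<mu>)" if "f \<in> bounded_measurable S" for f
      using assms(13)[OF s that] by (simp add: case_prod_beta')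
    show "\<delta> \<le> measure (P s) {z \<in> space (P s). 1 \<le> jump z}"
      unfolding \<delta>_def using s by (intro cINF_lower bdd_belowI2[where m=0]) auto
    show "(\<integral>\<^sup>+z. ennreal ((jump z)\<^sup>2) \<partial>P s) \<le> ennreal (enn2real B)"
      unfolding B unfolding B_def using s by (rule SUP_upper)
  next
    show "0 < \<delta>" using assms(14) unfolding \<delta>_def jump_sets .
    show "0 \<le> enn2real B" by simp
  qed (fact assms l lh)+
  show ?thesis
  proof (intro conjI ballI)
    fix f assume "f \<in> bounded_measurable S"
    from integral_tendsto[OF this] average_tendsto[OF this]
    show "AE \<omega> in M. (\<lambda>n. (\<integral>x. f x \<partial>U n \<omega>) / real n)
        \<longlonglongrightarrow> lambda1 * (\<integral>x. f x \<partial>normalized \<mu>)"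
      and "AE \<omega> in M. (\<lambda>n. \<integral>x. f x \<partial>normalized (U n \<omega>))
        \<longlonglongrightarrow> (\<integral>x. f x \<partial>normalized \<mu>)"
      unfolding avg_def assms(16) .
  qed
qed

end
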